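(* Let $S\subset\mathbb{R}$ be a measurable set and suppose that $|S_a|<a$ for some $a>0$, where $S_a:=(S+a\mathbb{Z})\cap[0,a]$ and $|\cdot|$ denotes Lebesgue measure. Then there is a uniformly discrete set $\Lambda\subset\mathbb{R}$ with uniform density $D(\Lambda)=a$ which is a uniqueness set for $W^{(\alpha)}_S$ for every $\alpha>1/2$.
   Context: Fourier transform: $\hat f(t)=\int_{\mathbb{R}} e^{-2\pi i t x}f(x)\,dx$. For $\alpha>1/2$, $W^{(\alpha)}$ is the space of functions $f$ whose Fourier transform $F=\hat f$ satisfies $\int_{\mathbb{R}}(1+|t|^{2\alpha})|F(t)|^2\,dt<\infty$ (such $F$ are integrable, so $f$ is continuous); $W^{(\alpha)}_S$ is the subspace of those $f$ with $F=0$ a.e. outside $S$. A set $\Lambda\subset\mathbb{R}$ is uniformly discrete if $\inf\{|\lambda-\lambda'|:\lambda,\lambda'\in\Lambda,\lambda\neq\lambda'\}>0$. It has uniform density $D(\Lambda)$ if $\mathrm{Card}(\Lambda\cap(x,x+r))=rD(\Lambda)+o(r)$ uniformly in $x$ as $r\to\infty$. A set $\Lambda$ is a uniqueness set for a space $F$ of continuous functions if $f\in F$, $f|_\Lambda=0$ imply $f=0$. *)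

theory Defs
  imports "HOL-Analysis.Analysis"
begin

text \<open>Fourier-side description of the Sobolev-type space W^(alpha)_S:
  f = inverse Fourier transform of F, where F is Lebesgue measurable,
  the weighted integral of (1+|t|^(2 alpha))|F(t)|^2 is finite, and F = 0 a.e.
  outside S. (For alpha > 1/2 such F are integrable, so f is continuous and
  given pointwise by the integral.)\<close>
definition W_space :: "real \<Rightarrow> real set \<Rightarrow> (real \<Rightarrow> complex) set" where
  "W_space \<alpha> S = {f. \<exists>F :: real \<Rightarrow> complex.
      F \<in> borel_measurable lebesgue \<and>
      integrable lebesgue (\<lambda>t. (1 + \<bar>t\<bar> powr (2 * \<alpha>)) * (cmod (F t))\<^sup>2) \<and>
      (AE t in lebesgue. t \<notin> S \<longrightarrow> F t = 0) \<and>
      (\<forall>x. f x = (LINT t|lebesgue. exp (complex_of_real (2 * pi * t * x) * \<i>) * F t))}"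

definition uniformly_discrete :: "real set \<Rightarrow> bool" where
  "uniformly_discrete \<Lambda> \<longleftrightarrow>
     (\<exists>\<delta>>0. \<forall>l\<in>\<Lambda>. \<forall>m\<in>\<Lambda>. l \<noteq> m \<longrightarrow> \<delta> \<le> \<bar>l - m\<bar>)"

definition has_uniform_density :: "real set \<Rightarrow> real \<Rightarrow> bool" where
  "has_uniform_density \<Lambda> D \<longleftrightarrow>
     (\<forall>x r. finite (\<Lambda> \<inter> {x<..<x+r})) \<and>
     (\<forall>\<epsilon>>0. \<exists>R. \<forall>r\<ge>R. \<forall>x.
        \<bar>real (card (\<Lambda> \<inter> {x<..<x+r})) - r * D\<bar> \<le> \<epsilon> * r)"

definition uniqueness_set :: "real set \<Rightarrow> (real \<Rightarrow> complex) set \<Rightarrow> bool" where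
  "uniqueness_set \<Lambda> F \<longleftrightarrow> (\<forall>f\<in>F. (\<forall>l\<in>\<Lambda>. f l = 0) \<longrightarrow> f = (\<lambda>_. 0))"

definition periodized_trace :: "real set \<Rightarrow> real \<Rightarrow> real set" where
  "periodized_trace S a = {y. \<exists>s\<in>S. \<exists>k::int. y = s + a * of_int k} \<inter> {0..a}"

end

theory Submission
  imports Defs
begin

text \<open>
  After replacing \<open>f\<close> by its Fourier transform \<open>F\<close>, the samples \<open>f ((n + \<delta>) / a)\<close>, for \<open>\<delta>\<close> fixed,
  are Fourier coefficients of an \<open>a\<close>-periodization which is square integrable (this uses
  \<open>\<alpha> > 1/2\<close>) and vanishes off \<open>S + a\<int>\<close>, hence on a fixed closed set \<open>E\<close> of positive measure.

  No nonzero trigonometric polynomial vanishes on \<open>E\<close>. Hence for every \<open>M\<close> some function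
  supported on \<open>E\<close> has prescribed Fourier coefficients at the frequencies \<open>\<bar>n\<bar> \<le> M\<close>; approximating it
  gives, for \<open>\<bar>m\<bar> \<le> M\<close>, a trigonometric polynomial with frequency \<open>m\<close> (coefficient 1) and
  otherwise only frequencies in \<open>M < \<bar>n\<bar> \<le> N\<close> that is as small as we like in \<open>L\<^sup>2\<close> off \<open>E\<close>. So if
  \<open>f ((n + \<delta>) / a) = 0\<close> for all \<open>M < \<bar>n\<bar> \<le> N\<close>, then \<open>f ((m + \<delta>) / a)\<close> is small for \<open>\<bar>m\<bar> \<le> M\<close>.

  Therefore cut the integers into such rapidly growing blocks, use one shift \<open>\<delta>\<close> in each block, and
  let every rational \<open>\<delta> \<in> [0, 1)\<close> occur infinitely often. The resulting \<open>\<Lambda>\<close> is a bounded perturbation of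
  \<open>\<int> / a\<close>, and \<open>f = 0\<close> on \<open>\<Lambda>\<close> forces \<open>f ((m + \<delta>) / a) = 0\<close> for all integers \<open>m\<close> and a dense set of \<open>\<delta>\<close>.
\<close>

section \<open>Trigonometric polynomials on the circle\<close>

text \<open>Induction on \<open>A\<close>: the hypothesis is applied on the kernel of
  \<open>L b\<close>, which is why \<open>V\<close> is generalized, and one vector off that kernel
  fixes the missing coefficient. Used in contrapositive form, to find a \<open>v\<close> killed by
  every \<open>L i\<close> but not by \<open>K\<close>.\<close>

lemma functional_in_span_if_kernel:
  fixes V :: "('x \<Rightarrow> complex) set" and L :: "'i \<Rightarrow> ('x \<Rightarrow> complex) \<Rightarrow> complex"
  assumes "finite A"
    and "\<And>u v c. u \<in> V \<Longrightarrow> v \<in> V \<Longrightarrow> (\<lambda>x. u x + c * v x) \<in> V"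
    and "\<And>i u v c. u \<in> V \<Longrightarrow> v \<in> V \<Longrightarrow> L i (\<lambda>x. u x + c * v x) = L i u + c * L i v"
    and "\<And>u v c. u \<in> V \<Longrightarrow> v \<in> V \<Longrightarrow> K (\<lambda>x. u x + c * v x) = K u + c * K v"
    and "\<And>v. v \<in> V \<Longrightarrow> (\<forall>i\<in>A. L i v = 0) \<Longrightarrow> K v = 0"
  shows "\<exists>c. \<forall>v\<in>V. K v = (\<Sum>i\<in>A. c i * L i v)"
  using assms
proof (induction A arbitrary: V rule: finite_induct)
  case empty
  then show ?case by auto
next
  case (insert b A)
  note lin = insert.prems
  define V' where "V' = {v\<in>V. L b v = 0}"
  have "\<exists>c. \<forall>v\<in>V'. K v = (\<Sum>i\<in>A. c i * L i v)"
    by (rule insert.IH) (use lin in \<open>auto simp: V'_def\<close>)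
  then obtain c where c: "\<And>v. v \<in> V' \<Longrightarrow> K v = (\<Sum>i\<in>A. c i * L i v)" by blast
  show ?case
  proof (cases "\<exists>w\<in>V. L b w \<noteq> 0")
    case False
    then have "V' = V" by (auto simp: V'_def)
    then have "\<forall>v\<in>V. K v = (\<Sum>i\<in>insert b A. c i * L i v)"
      using c False insert.hyps by auto
    then show ?thesis by blast
  next
    case True
    then obtain w where w: "w \<in> V" "L b w \<noteq> 0" by blast
    \<comment> \<open>The value forced by the identity at \<open>w\<close>. Every \<open>v\<close>
      differs from a multiple of \<open>w\<close> by an element of \<open>V'\<close>, so this
      suffices.\<close>
    define d where "d = (K w - (\<Sum>i\<in>A. c i * L i w)) / L b w"
    have "K v = (\<Sum>i\<in>insert b A. (c(b := d)) i * L i v)" if v: "v \<in> V" for v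
    proof -
      define s where "s = L b v / L b w"
      let ?u = "\<lambda>x. v x + (- s) * w x"
      have "?u \<in> V" using v w(1) by (rule lin(1))
      moreover have "L b ?u = 0"
        using lin(2)[OF v w(1), of b "- s"] w by (simp add: s_def)
      ultimately have u: "?u \<in> V'" by (simp add: V'_def)
      have "K v - s * K w = K ?u"
        using lin(3)[OF v w(1), of "- s"] by simp
      also have "\<dots> = (\<Sum>i\<in>A. c i * (L i v - s * L i w))"
        unfolding c[OF u] using lin(2)[OF v w(1), of _ "- s"] by simp
      also have "\<dots> = (\<Sum>i\<in>A. c i * L i v) - s * (\<Sum>i\<in>A. c i * L i w)"
        by (simp add: sum_distrib_left sum_subtractf algebra_simps)
      finally have "K v = (\<Sum>i\<in>A. c i * L i v) + s * (K w - (\<Sum>i\<in>A. c i * L i w))"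
        by (simp add: algebra_simps)
      also have "s * (K w - (\<Sum>i\<in>A. c i * L i w)) = d * L b v"
        by (simp add: s_def d_def)
      also have "(\<Sum>i\<in>A. c i * L i v) = (\<Sum>i\<in>A. (c(b := d)) i * L i v)"
        using insert.hyps by (intro sum.cong) auto
      finally show ?thesis using insert.hyps by simp
    qed
    then show ?thesis by blast
  qed
qed

section \<open>Characters and Lebesgue measure on the circle of length \<open>a\<close>\<close>

text \<open>The characters of the circle of length \<open>a\<close>. \<open>harmonic a 1\<close>
  also serves as the covering map from the line onto the unit circle in the complex plane, so that
  \<open>a\<close>-periodic sets can be described by subsets of that circle.\<close>

definition harmonic :: "real \<Rightarrow> int \<Rightarrow> real \<Rightarrow> complex" where
  "harmonic a n t = cis (of_int n * (2 * pi * t / a))"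

lemma norm_harmonic [simp]: "norm (harmonic a n t) = 1"
  by (simp add: harmonic_def)

lemma harmonic_0 [simp]: "harmonic a 0 t = 1"
  by (simp add: harmonic_def)

lemma harmonic_mult: "harmonic a m t * harmonic a n t = harmonic a (m + n) t"
  by (simp add: harmonic_def cis_mult ring_distribs add_divide_distrib)

lemma cnj_harmonic: "cnj (harmonic a n t) = harmonic a (- n) t"
  by (simp add: harmonic_def cis_cnj)

lemma harmonic_conv_powi: "harmonic a n t = harmonic a 1 t powi n"
  by (simp add: harmonic_def cis_power_int)

lemma continuous_on_harmonic [continuous_intros]:
  "continuous_on A (harmonic a n)"
  unfolding harmonic_def divide_inverse by (intro continuous_intros)

lemma borel_measurable_harmonic [measurable]: "harmonic a n \<in> borel_measurable borel"
  by (intro borel_measurable_continuous_onI continuous_intros)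

lemma harmonic_eq_iff:
  assumes "a > 0"
  shows "harmonic a 1 s = harmonic a 1 t \<longleftrightarrow> (\<exists>k::int. s = t + a * of_int k)"
proof -
  have "harmonic a 1 s = harmonic a 1 t \<longleftrightarrow>
      (\<exists>k::int. 2 * pi * s / a = 2 * pi * t / a + 2 * pi * k)"
    unfolding harmonic_def using sin_cos_eq_iff[of "2 * pi * s / a" "2 * pi * t / a"]
    by (auto simp: complex_eq_iff)
  also have "\<dots> \<longleftrightarrow> (\<exists>k::int. s = t + a * of_int k)"
  proof (intro ex_cong1)
    fix k :: int
    have "2 * pi * t / a + 2 * pi * k = 2 * pi * (t + a * k) / a"
      using assms by (simp add: field_simps)
    then show "2 * pi * s / a = 2 * pi * t / a + 2 * pi * k \<longleftrightarrow> s = t + a * of_int k"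
      using assms by simp
  qed
  finally show ?thesis .
qed

lemma harmonic_periodic:
  assumes "a > 0"
  shows "harmonic a n (t + a * of_int k) = harmonic a n t"
  using harmonic_eq_iff[OF assms, of "t + a * of_int k" t] harmonic_conv_powi by metis

text \<open>Unnormalised, with total mass \<open>a\<close>; hence the factors \<open>a\<close> in
  the coefficient formulas. The endpoints 0 and \<open>a\<close> are the same point of the circle,
  which is harmless because single points are null.\<close>

definition circle_measure :: "real \<Rightarrow> real measure" where
  "circle_measure a = restrict_space lborel {0..a}"

lemma space_circle_measure [simp]: "space (circle_measure a) = {0..a}"
  by (simp add: circle_measure_def space_restrict_space)

lemma measurable_circle_measure [measurable (raw)]:
  "f \<in> borel_measurable borel \<Longrightarrow> f \<in> borel_measurable (circle_measure a)"
  unfolding circle_measure_def by (rule measurable_restrict_space1) simp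

lemma measure_space_circle: "a > 0 \<Longrightarrow> measure (circle_measure a) {0..a} = a"
  unfolding circle_measure_def by (subst measure_restrict_space) auto

lemma finite_measure_circle: "finite_measure (circle_measure a)"
  unfolding circle_measure_def
  by (rule finite_measureI) (auto simp: emeasure_restrict_space space_restrict_space emeasure_lborel_Icc_eq)

lemma integrable_circle_bounded:
  fixes f :: "real \<Rightarrow> 'b::{banach, second_countable_topology}"
  assumes "f \<in> borel_measurable borel" "\<And>t. norm (f t) \<le> B"
  shows "integrable (circle_measure a) f"
  by (rule finite_measure.integrable_const_bound[OF finite_measure_circle])
     (use assms in \<open>auto intro: measurable_circle_measure\<close>)

lemma integral_harmonic:
  assumes "a > 0"
  shows "(LINT t|circle_measure a. harmonic a n t) = (if n = 0 then a else 0)"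
proof (cases "n = 0")
  case True
  then show ?thesis using assms by (simp add: measure_space_circle scaleR_conv_of_real)
next
  case False
  define c where "c = 2 * pi * of_int n / a"
  have c: "c \<noteq> 0" using False assms by (simp add: c_def)
  have h: "harmonic a n t = cis (c * t)" for t by (simp add: harmonic_def c_def mult_ac)
  have "((\<lambda>t. cis (c * t)) has_integral (cis (c * a) / (\<i> * c) - cis (c * 0) / (\<i> * c))) {0..a}"
  proof (rule fundamental_theorem_of_calculus)
    fix x assume "x \<in> {0..a}"
    show "((\<lambda>t. cis (c * t) / (\<i> * c)) has_vector_derivative cis (c * x)) (at x within {0..a})"
      unfolding has_vector_derivative_def
      by (rule derivative_eq_intros refl | use c in \<open>simp add: scaleR_conv_of_real field_simps\<close>)+
  qed (use assms in auto)
  moreover have "cis (c * a) = 1"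
    using harmonic_periodic[OF assms, of n 0 1] h[of a] by (simp add: harmonic_def)
  ultimately have "integral {0..a} (harmonic a n) = 0"
    using integral_unique[of "\<lambda>t. cis (c * t)" 0 "{0..a}"] by (simp add: h[abs_def])
  moreover have "set_integrable lborel {0..a} (harmonic a n)"
    unfolding set_integrable_def
    by (intro borel_integrable_compact) (auto intro!: continuous_intros)
  ultimately show ?thesis
    using False set_borel_integral_eq_integral(2)[of "{0..a}" "harmonic a n"]
    by (simp add: circle_measure_def integral_restrict_space set_lebesgue_integral_def)
qed

section \<open>Trigonometric polynomials and approximation by them\<close>

text \<open>Inductive, so that closure under products and boundedness follow by rule induction;
  explicit coefficients are recovered in \<open>trig_poly_coefficients\<close>.\<close>

inductive_set trig_poly :: "real \<Rightarrow> (real \<Rightarrow> complex) set" for a :: real where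
  harmonic: "(\<lambda>t. c * harmonic a n t) \<in> trig_poly a"
| add: "p \<in> trig_poly a \<Longrightarrow> q \<in> trig_poly a \<Longrightarrow> (\<lambda>t. p t + q t) \<in> trig_poly a"

lemma trig_poly_const: "(\<lambda>t. c) \<in> trig_poly a"
  using trig_poly.harmonic[of c a 0] by simp

lemma trig_poly_mult:
  assumes "p \<in> trig_poly a" "q \<in> trig_poly a"
  shows "(\<lambda>t. p t * q t) \<in> trig_poly a"
  using assms(1)
proof induction
  case (harmonic c n)
  show ?case using assms(2)
  proof induction
    case (harmonic d m)
    have "(\<lambda>t. c * harmonic a n t * (d * harmonic a m t)) = (\<lambda>t. (c * d) * harmonic a (n + m) t)"
      by (simp add: harmonic_mult[symmetric] mult_ac)
    then show ?case using trig_poly.harmonic[of "c * d" a "n + m"] by simp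
  next
    case (add q r)
    then show ?case using trig_poly.add[OF add.IH] by (simp add: ring_distribs)
  qed
next
  case (add p r)
  then show ?case using trig_poly.add[OF add.IH] by (simp add: ring_distribs)
qed

lemma trig_sum_extend:
  fixes b :: "int \<Rightarrow> complex"
  assumes "\<And>n. \<bar>n\<bar> > N \<Longrightarrow> b n = 0" "N \<le> N'"
  shows "(\<Sum>n\<in>{-N'..N'}. b n * h n) = (\<Sum>n\<in>{-N..N}. b n * h n)"
  using assms by (intro sum.mono_neutral_right) auto

text \<open>Making \<open>b\<close> vanish beyond \<open>N\<close> allows sums with different ranges
  to be extended to a common one, here when adding and later when enlarging
  \<open>N\<close>.\<close>

lemma trig_poly_coefficients:
  assumes "p \<in> trig_poly a"
  obtains N :: int and b where "\<And>n. \<bar>n\<bar> > N \<Longrightarrow> b n = 0"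
    "\<And>t. p t = (\<Sum>n\<in>{-N..N}. b n * harmonic a n t)"
proof -
  have "\<exists>N b. (\<forall>n. \<bar>n\<bar> > N \<longrightarrow> b n = 0) \<and> (\<forall>t. p t = (\<Sum>n\<in>{-N..N}. b n * harmonic a n t))"
    using assms
  proof induction
    case (harmonic c m)
    have "(\<Sum>n\<in>{-\<bar>m\<bar>..\<bar>m\<bar>}. (if n = m then c else 0) * harmonic a n t) = c * harmonic a m t" for t
      by (subst sum.remove[of _ m]) auto
    then show ?case
      by (intro exI[of _ "\<bar>m\<bar>"] exI[of _ "\<lambda>n. if n = m then c else 0"]) auto
  next
    case (add p q)
    then obtain N b N' b' where
      b: "\<And>n. \<bar>n\<bar> > N \<Longrightarrow> b n = 0" "\<And>t. p t = (\<Sum>n\<in>{-N..N}. b n * harmonic a n t)" and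
      b': "\<And>n. \<bar>n\<bar> > N' \<Longrightarrow> b' n = 0" "\<And>t. q t = (\<Sum>n\<in>{-N'..N'}. b' n * harmonic a n t)"
      by blast
    let ?N = "max N N'"
    have "p t + q t = (\<Sum>n\<in>{-?N..?N}. (b n + b' n) * harmonic a n t)" for t
      using trig_sum_extend[of N b ?N "\<lambda>n. harmonic a n t"]
        trig_sum_extend[of N' b' ?N "\<lambda>n. harmonic a n t"] b b'
      by (simp add: sum.distrib ring_distribs)
    then show ?case
      using b(1) b'(1) by (intro exI[of _ ?N] exI[of _ "\<lambda>n. b n + b' n"]) auto
  qed
  then show thesis using that by blast
qed

text \<open>A real-linear function on the plane is a combination of \<open>z\<close> and
  \<open>cnj z\<close>, and on the unit circle \<open>cnj z\<close> is the character of frequency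
  -1. Sums and products then stay in the class.\<close>

lemma trig_poly_real_polynomial:
  fixes g :: "complex \<Rightarrow> real"
  assumes "real_polynomial_function g"
  shows "(\<lambda>t. complex_of_real (g (harmonic a 1 t))) \<in> trig_poly a"
  using assms
proof induction
  case (linear f)
  interpret f: bounded_linear f by fact
  \<comment> \<open>Obtained by substituting Re z = (z + cnj z) / 2 and Im z = (z - cnj z) / (2
    \<open>\<i>\<close>) into f z = Re z * f 1 + Im z * f \<open>\<i>\<close>.\<close>
  let ?c = "(of_real (f 1) - \<i> * of_real (f \<i>)) / 2" and ?d = "(of_real (f 1) + \<i> * of_real (f \<i>)) / 2"
  have "complex_of_real (f (harmonic a 1 t)) = ?c * harmonic a 1 t + ?d * harmonic a (-1) t" for t
  proof -
    let ?z = "harmonic a 1 t"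
    have z: "?z = Re ?z *\<^sub>R 1 + Im ?z *\<^sub>R \<i>" by (simp add: complex_eq_iff)
    have "f ?z = Re ?z * f 1 + Im ?z * f \<i>"
      by (subst z) (simp only: f.add f.scaleR real_scaleR_def)
    moreover have "harmonic a (-1) t = cnj ?z" by (simp add: cnj_harmonic)
    ultimately show ?thesis by (simp add: complex_eq_iff field_simps)
  qed
  then show ?case
    using trig_poly.add[OF trig_poly.harmonic[of ?c a 1] trig_poly.harmonic[of ?d a "-1"]] by simp
next
  case (const c)
  show ?case by (rule trig_poly_const)
next
  case (add f g)
  then show ?case using trig_poly.add[OF add.IH] by simp
next
  case (mult f g)
  then show ?case using trig_poly_mult[OF mult.IH] by simp
qed

text \<open>Stone-Weierstrass on the unit circle, for real and imaginary parts separately. Working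
  on the circle instead of the interval builds in the matching of the endpoints.\<close>

lemma trig_poly_uniform_approx:
  fixes G :: "complex \<Rightarrow> complex"
  assumes "continuous_on (sphere 0 1) G" "e > 0"
  obtains p where "p \<in> trig_poly a" "\<And>t. norm (G (harmonic a 1 t) - p t) < e"
proof -
  obtain g where g: "polynomial_function g" "\<And>z. z \<in> sphere 0 1 \<Longrightarrow> norm (G z - g z) < e"
    using Stone_Weierstrass_polynomial_function[OF compact_sphere assms] by blast
  have "real_polynomial_function (Re \<circ> g)" "real_polynomial_function (Im \<circ> g)"
    using g(1) bounded_linear_Re bounded_linear_Im unfolding polynomial_function_def by blast+
  from this[THEN trig_poly_real_polynomial, of a]
  have "(\<lambda>t. of_real (Re (g (harmonic a 1 t))) + \<i> * of_real (Im (g (harmonic a 1 t)))) \<in> trig_poly a"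
    using trig_poly_mult[OF trig_poly_const] by (intro trig_poly.add) auto
  then have "(\<lambda>t. g (harmonic a 1 t)) \<in> trig_poly a"
    by (simp add: complex_eq[symmetric])
  then show thesis using g(2) by (intro that) auto
qed

lemma borel_measurable_trig_poly [measurable_dest]:
  assumes "p \<in> trig_poly a"
  shows "p \<in> borel_measurable borel"
  using assms by induction auto

lemma bounded_trig_poly:
  assumes "p \<in> trig_poly a"
  obtains B where "\<And>t. norm (p t) \<le> B"
proof -
  have "\<exists>B. \<forall>t. norm (p t) \<le> B" using assms
  proof induction
    case (harmonic c n)
    show ?case by (intro exI[of _ "norm c"]) (simp add: norm_mult)
  next
    case (add p q)
    then show ?case by (meson norm_add_rule_thm norm_triangle_mono)
  qed
  then show thesis using that by blast
qed

lemma borel_measurable_compose_harmonic: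
  assumes "continuous_on (sphere 0 1) v"
  shows "(\<lambda>t. v (harmonic a 1 t)) \<in> borel_measurable borel"
  by (intro borel_measurable_continuous_onI continuous_on_compose2[OF assms] continuous_intros) auto

text \<open>The indicator is first replaced by continuous cutoffs, close in L1 by dominated
  convergence, and the result is then approximated uniformly. The pointwise bound is kept because it
  later upgrades L1 smallness to L2 smallness.\<close>

lemma trig_poly_L1_approx:
  fixes v :: "complex \<Rightarrow> complex"
  assumes "a > 0" "closed C" "C \<noteq> {}" "continuous_on (sphere 0 1) v" "\<And>z. norm z = 1 \<Longrightarrow> norm (v z) \<le> B" "\<eta> > 0"
  obtains p where "p \<in> trig_poly a"
    "\<And>t. norm (indicator C (harmonic a 1 t) * v (harmonic a 1 t) - p t) \<le> B + 1"
    "(LINT t|circle_measure a. norm (indicator C (harmonic a 1 t) * v (harmonic a 1 t) - p t)) \<le> \<eta>"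
proof -
  let ?e = "harmonic a 1"
  let ?\<phi> = "\<lambda>t. indicator C (?e t) * v (?e t)"
  \<comment> \<open>Lipschitz cutoffs decreasing to the indicator of \<open>C\<close>. As
    \<open>infdist\<close> to the empty set is 0 by convention, \<open>C\<close> has to be nonempty
    for this.\<close>
  define \<psi> where "\<psi> k z = max 0 (1 - real k * infdist z C)" for k z
  have \<psi>_cont: "continuous_on UNIV (\<psi> k)" for k
    unfolding \<psi>_def by (intro continuous_intros)
  have [measurable]: "(\<lambda>t. v (?e t)) \<in> borel_measurable borel" "C \<in> sets borel"
    using assms by (auto intro: borel_measurable_compose_harmonic)
  have [measurable]: "\<psi> k \<in> borel_measurable borel" for k
    using \<psi>_cont by (auto intro: borel_measurable_continuous_onI)
  have \<psi>_in: "\<psi> k z = 1" if "z \<in> C" for k z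
    using that by (simp add: \<psi>_def)
  have \<psi>_range: "0 \<le> \<psi> k z" "\<psi> k z \<le> 1" for k z
    by (auto simp: \<psi>_def infdist_nonneg)
  have \<psi>_tendsto: "(\<lambda>k. indicator C z - \<psi> k z) \<longlonglongrightarrow> 0" for z
  proof (cases "z \<in> C")
    case False
    then have d: "infdist z C > 0"
      using assms in_closed_iff_infdist_zero[of C z] infdist_nonneg[of z C] by force
    obtain K :: nat where K: "1 / infdist z C < real K" using reals_Archimedean2 by blast
    have "indicator C z - \<psi> k z = 0" if "k \<ge> K" for k
    proof -
      have "1 / infdist z C < real k" using K that by linarith
      then have "1 < real k * infdist z C" using d by (simp add: field_simps)
      then show ?thesis using False by (simp add: \<psi>_def)
    qed
    then show ?thesis by (intro tendsto_eventually eventually_sequentiallyI) auto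
  qed (simp add: \<psi>_in)
  have diff: "norm (?\<phi> t - \<psi> k (?e t) * v (?e t)) = \<bar>indicator C (?e t) - \<psi> k (?e t)\<bar> * norm (v (?e t))" for k t
  proof -
    have "?\<phi> t - \<psi> k (?e t) * v (?e t) = of_real (indicator C (?e t) - \<psi> k (?e t)) * v (?e t)"
      by (simp add: left_diff_distrib of_real_indicator)
    then show ?thesis by (simp only: norm_mult norm_of_real)
  qed
  have bd: "norm (?\<phi> t - \<psi> k (?e t) * v (?e t)) \<le> B" for k t
  proof -
    have "\<bar>indicator C (?e t) - \<psi> k (?e t)\<bar> \<le> 1"
      using \<psi>_range[of k "?e t"] by (auto simp: indicator_def abs_le_iff)
    then have "\<bar>indicator C (?e t) - \<psi> k (?e t)\<bar> * norm (v (?e t)) \<le> 1 * B"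
      using assms(5)[of "?e t"] by (intro mult_mono) auto
    then show ?thesis by (simp only: diff)
  qed
  have "(\<lambda>k. LINT t|circle_measure a. norm (?\<phi> t - \<psi> k (?e t) * v (?e t)))
      \<longlonglongrightarrow> (LINT t|circle_measure a. 0)"
  proof (rule integral_dominated_convergence[where w = "\<lambda>_. B"])
    show "integrable (circle_measure a) (\<lambda>_. B)"
      by (rule integrable_circle_bounded[where B = "\<bar>B\<bar>"]) auto
    show "AE t in circle_measure a. norm (norm (?\<phi> t - \<psi> k (?e t) * v (?e t))) \<le> B" for k
      using bd by simp
    show "AE t in circle_measure a. (\<lambda>k. norm (?\<phi> t - \<psi> k (?e t) * v (?e t))) \<longlonglongrightarrow> 0"
      unfolding diff using tendsto_mult_left_zero[OF tendsto_rabs_zero[OF \<psi>_tendsto]] by simp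
  qed (auto intro!: measurable_circle_measure)
  then obtain k where k: "(LINT t|circle_measure a. norm (?\<phi> t - \<psi> k (?e t) * v (?e t))) < \<eta> / 2"
    using assms(6) order_tendstoD(2)[of _ "0::real" sequentially "\<eta> / 2"]
    by (auto simp: eventually_sequentially)
  \<comment> \<open>The bound by 1 yields \<open>B + 1\<close>, and the total mass \<open>a\<close>
    turns \<open>\<eta> / (2 * a)\<close> into the second half of the budget
    \<open>\<eta>\<close>.\<close>
  define \<tau> where "\<tau> = min 1 (\<eta> / (2 * a))"
  have \<tau>: "\<tau> > 0" "\<tau> \<le> 1" "\<tau> * a \<le> \<eta> / 2"
    using assms by (auto simp: \<tau>_def min_def field_simps)
  have "continuous_on (sphere 0 1) (\<lambda>z. \<psi> k z * v z)"
    by (intro continuous_intros continuous_on_subset[OF \<psi>_cont] assms(4)) auto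
  then obtain p where p: "p \<in> trig_poly a" "\<And>t. norm (\<psi> k (?e t) * v (?e t) - p t) < \<tau>"
    using trig_poly_uniform_approx[OF _ \<tau>(1), of "\<lambda>z. \<psi> k z * v z" a] by blast
  have [measurable]: "p \<in> borel_measurable borel" using p(1) by measurable
  have tri: "norm (?\<phi> t - p t) \<le> norm (?\<phi> t - \<psi> k (?e t) * v (?e t)) + \<tau>" for t
    using norm_triangle_ineq[of "?\<phi> t - \<psi> k (?e t) * v (?e t)" "\<psi> k (?e t) * v (?e t) - p t"] p(2)[of t]
    by simp
  show thesis
  proof (rule that[OF p(1)])
    show bd2: "norm (?\<phi> t - p t) \<le> B + 1" for t
      using tri[of t] bd[of t k] \<tau> by linarith
    have int: "integrable (circle_measure a) (\<lambda>t. norm (?\<phi> t - \<psi> k (?e t) * v (?e t)))"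
      using bd by (intro integrable_circle_bounded[where B = B]) auto
    have "(LINT t|circle_measure a. norm (?\<phi> t - p t)) \<le>
        (LINT t|circle_measure a. norm (?\<phi> t - \<psi> k (?e t) * v (?e t)) + \<tau>)"
    proof (intro integral_mono tri Bochner_Integration.integrable_add int)
      show "integrable (circle_measure a) (\<lambda>t. norm (?\<phi> t - p t))"
        using bd2 by (intro integrable_circle_bounded[where B = "B + 1"]) auto
      show "integrable (circle_measure a) (\<lambda>t. \<tau>)"
        by (rule integrable_circle_bounded[where B = "\<bar>\<tau>\<bar>"]) auto
    qed
    also have "\<dots> = (LINT t|circle_measure a. norm (?\<phi> t - \<psi> k (?e t) * v (?e t))) + \<tau> * a"
      using int assms(1) by (subst Bochner_Integration.integral_add)
        (auto intro!: integrable_circle_bounded[where B = "\<bar>\<tau>\<bar>"] simp: measure_space_circle)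
    also have "\<dots> \<le> \<eta>" using k \<tau>(3) by linarith
    finally show "(LINT t|circle_measure a. norm (?\<phi> t - p t)) \<le> \<eta>" .
  qed
qed

section \<open>Zeros of trigonometric sums and biorthogonal functions\<close>

text \<open>Multiplication by \<open>harmonic a M\<close> makes the sum an ordinary nonzero
  polynomial in \<open>harmonic a 1 t\<close>. It has finitely many roots, each with finitely many
  preimages in one period.\<close>

lemma finite_zeros_trig_sum:
  assumes "a > 0" "\<bar>m\<bar> \<le> M" "b m \<noteq> 0"
  shows "finite {t\<in>{0..a}. (\<Sum>n\<in>{-M..M}. b n * harmonic a n t) = 0}"
proof -
  let ?e = "harmonic a 1"
  define d where "d i = b (int i - M)" for i
  define R where "R = {z. (\<Sum>i\<le>nat (2 * M). d i * z ^ i) = 0}"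
  have "d (nat (m + M)) \<noteq> 0" "nat (m + M) \<le> nat (2 * M)" using assms by (auto simp: d_def)
  then have R: "finite R" unfolding R_def polyfun_finite_roots by blast
  have eq: "harmonic a M t * (\<Sum>n\<in>{-M..M}. b n * harmonic a n t) = (\<Sum>i\<le>nat (2 * M). d i * ?e t ^ i)" for t
  proof -
    have "harmonic a M t * (\<Sum>n\<in>{-M..M}. b n * harmonic a n t) = (\<Sum>n\<in>{-M..M}. b n * harmonic a (n + M) t)"
      by (simp add: sum_distrib_left harmonic_mult[symmetric] mult_ac)
    also have "\<dots> = (\<Sum>i\<le>nat (2 * M). d i * ?e t ^ i)"
    proof (rule sum.reindex_bij_witness[of _ "\<lambda>i. int i - M" "\<lambda>n. nat (n + M)"])
      fix n assume n: "n \<in> {-M..M}"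
      then have "harmonic a (n + M) t = ?e t ^ nat (n + M)"
        by (subst harmonic_conv_powi) (simp add: power_int_def)
      then show "d (nat (n + M)) * ?e t ^ nat (n + M) = b n * harmonic a (n + M) t"
        using n by (simp add: d_def)
    qed (use assms(2) in auto)
    finally show ?thesis .
  qed
  have fib: "finite {t\<in>{0..a}. ?e t = z}" for z
  proof (cases "\<exists>s\<in>{0..a}. ?e s = z")
    case True
    then obtain s where s: "s \<in> {0..a}" "?e s = z" by blast
    \<comment> \<open>Two points of the fibre differ by a multiple of \<open>a\<close> of size at
      most \<open>a\<close>; the outer candidates occur only at the endpoints.\<close>
    have "{t\<in>{0..a}. ?e t = z} \<subseteq> {s - a, s, s + a}"
    proof safe
      fix t assume t: "t \<in> {0..a}" "t \<noteq> s - a" "t \<noteq> s" "z = ?e t" "t \<notin> {}"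
      then obtain k :: int where k: "t = s + a * k" using harmonic_eq_iff[OF assms(1), of t s] s by auto
      have "\<bar>a * k\<bar> \<le> a" using s t k by auto
      then have "\<bar>k\<bar> \<le> 1" using assms(1) by (simp add: abs_mult)
      then have "k = -1 \<or> k = 0 \<or> k = 1" by linarith
      then show "t = s + a" using t k by auto
    qed
    then show ?thesis by (rule finite_subset) simp
  next
    case False
    then have "{t\<in>{0..a}. ?e t = z} = {}" by blast
    then show ?thesis by (simp only: finite.emptyI)
  qed
  have "{t\<in>{0..a}. (\<Sum>n\<in>{-M..M}. b n * harmonic a n t) = 0} \<subseteq> (\<Union>z\<in>R. {t\<in>{0..a}. ?e t = z})"
  proof
    fix t assume t: "t \<in> {t\<in>{0..a}. (\<Sum>n\<in>{-M..M}. b n * harmonic a n t) = 0}"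
    then have "?e t \<in> R" unfolding R_def using eq[of t] by simp
    then show "t \<in> (\<Union>z\<in>R. {t\<in>{0..a}. ?e t = z})" using t by blast
  qed
  then show ?thesis by (rule finite_subset) (use R fib in auto)
qed

lemma continuous_bounded_on_circle:
  fixes v :: "complex \<Rightarrow> complex"
  assumes "continuous_on (sphere 0 1) v"
  obtains B where "\<And>z. norm z = 1 \<Longrightarrow> norm (v z) \<le> B"
proof -
  have "bounded (v ` sphere 0 1)"
    using assms by (intro compact_imp_bounded compact_continuous_image) auto
  then obtain B where "\<forall>z\<in>sphere 0 1. norm (v z) \<le> B" unfolding bounded_iff by auto
  then show thesis by (intro that[of B]) auto
qed

lemma integrable_circle_cutoff:
  assumes "continuous_on (sphere 0 1) v" "closed C"
  shows "integrable (circle_measure a) (\<lambda>t. indicator C (harmonic a 1 t) * v (harmonic a 1 t) * harmonic a n t)"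
proof -
  obtain B where B: "\<And>z. norm z = 1 \<Longrightarrow> norm (v z) \<le> B"
    using continuous_bounded_on_circle[OF assms(1)] by blast
  have [measurable]: "(\<lambda>t. v (harmonic a 1 t)) \<in> borel_measurable borel" "C \<in> sets borel"
    using assms by (auto intro: borel_measurable_compose_harmonic)
  have "norm (indicator C (harmonic a 1 t) * v (harmonic a 1 t) * harmonic a n t) \<le> B" for t
    using B[of "harmonic a 1 t"] norm_ge_zero[of "v (harmonic a 1 t)"]
    by (auto simp: norm_mult indicator_def simp del: norm_ge_zero)
  then show ?thesis by (intro integrable_circle_bounded[where B = B]) auto
qed

text \<open>Otherwise the m-th coefficient functional would be a combination of the others, so some
  nonzero trigonometric sum would be orthogonal on \<open>C\<close> to every continuous
  \<open>v\<close>. Testing it against its own conjugate makes it vanish almost everywhere on a set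
  of positive measure, against \<open>finite_zeros_trig_sum\<close>.\<close>

lemma biorthogonal_function_on_circle:
  assumes "a > 0" "closed C" "emeasure (circle_measure a) {t\<in>{0..a}. harmonic a 1 t \<in> C} \<noteq> 0" "\<bar>m\<bar> \<le> M"
  obtains v where "continuous_on (sphere 0 1) v"
    "\<And>n. \<bar>n\<bar> \<le> M \<Longrightarrow>
      (LINT t|circle_measure a. indicator C (harmonic a 1 t) * v (harmonic a 1 t) * harmonic a (- n) t)
        = (if n = m then a else 0)"
proof -
  let ?e = "harmonic a 1" and ?\<mu> = "circle_measure a"
  define V :: "(complex \<Rightarrow> complex) set" where "V = {v. continuous_on (sphere 0 1) v}"
  define A where "A = {-M..M} - {m}"
  define L where "L n v = (LINT t|?\<mu>. indicator C (?e t) * v (?e t) * harmonic a (- n) t)" for n v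
  have V_lin: "(\<lambda>x. u x + c * v x) \<in> V" if "u \<in> V" "v \<in> V" for u v c
    using that by (auto simp: V_def intro!: continuous_intros)
  have int: "integrable ?\<mu> (\<lambda>t. indicator C (?e t) * v (?e t) * harmonic a n t)" if "v \<in> V" for v n
    using that assms(2) by (auto simp: V_def intro: integrable_circle_cutoff)
  have L_lin: "L n (\<lambda>x. u x + c * v x) = L n u + c * L n v" if "u \<in> V" "v \<in> V" for n u v c
  proof -
    have "L n (\<lambda>x. u x + c * v x) = (LINT t|?\<mu>. indicator C (?e t) * u (?e t) * harmonic a (- n) t
        + c * (indicator C (?e t) * v (?e t) * harmonic a (- n) t))"
      by (simp add: L_def algebra_simps)
    also have "\<dots> = L n u + c * L n v"
      using int[OF that(1)] int[OF that(2)] by (simp add: L_def)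
    finally show ?thesis .
  qed
  have "\<exists>v\<in>V. (\<forall>n\<in>A. L n v = 0) \<and> L m v \<noteq> 0"
  proof (rule ccontr)
    assume no: "\<not> ?thesis"
    have "\<exists>c. \<forall>v\<in>V. L m v = (\<Sum>n\<in>A. c n * L n v)"
      by (rule functional_in_span_if_kernel[OF _ V_lin L_lin L_lin]) (use no in \<open>auto simp: A_def\<close>)
    then obtain c where c: "\<And>v. v \<in> V \<Longrightarrow> L m v = (\<Sum>n\<in>A. c n * L n v)" by blast
    define b where "b n = (if n = m then 1 else - c n)" for n
    have bL: "(\<Sum>n\<in>{-M..M}. b n * L n v) = 0" if "v \<in> V" for v
    proof -
      have "(\<Sum>n\<in>{-M..M}. b n * L n v) = b m * L m v + (\<Sum>n\<in>A. b n * L n v)"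
        unfolding A_def using assms(4) by (intro sum.remove) auto
      also have "(\<Sum>n\<in>A. b n * L n v) = - (\<Sum>n\<in>A. c n * L n v)"
        unfolding sum_negf[symmetric] by (intro sum.cong) (auto simp: A_def b_def)
      finally show ?thesis using c[OF that] by (simp add: b_def)
    qed
    \<comment> \<open>On the circle this is the conjugate of the trigonometric sum in the relation
      \<open>bL\<close>, so that relation becomes the vanishing of the integral of the squared
      modulus over \<open>C\<close>.\<close>
    define v where "v z = (\<Sum>n\<in>{-M..M}. cnj (b n) * z powi n)" for z
    have v: "v \<in> V" unfolding V_def v_def by (auto intro!: continuous_intros)
    have ve: "v (?e t) = (\<Sum>n\<in>{-M..M}. cnj (b n) * harmonic a n t)" for t
      by (simp add: v_def harmonic_conv_powi[symmetric])
    have cnj_ve: "cnj (v (?e t)) = (\<Sum>n\<in>{-M..M}. b n * harmonic a (- n) t)" for t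
      by (simp add: ve cnj_harmonic)
    have [measurable]: "(\<lambda>t. v (?e t)) \<in> borel_measurable borel" "C \<in> sets borel"
      using v assms(2) by (auto simp: V_def intro: borel_measurable_compose_harmonic)
    have eq: "complex_of_real (indicator C (?e t) * (norm (v (?e t)))\<^sup>2) =
        (\<Sum>n\<in>{-M..M}. b n * (indicator C (?e t) * v (?e t) * harmonic a (- n) t))" for t
    proof -
      have "complex_of_real (indicator C (?e t) * (norm (v (?e t)))\<^sup>2) =
          indicator C (?e t) * v (?e t) * cnj (v (?e t))"
        by (simp add: of_real_indicator complex_norm_square[symmetric] mult.assoc)
      then show ?thesis
        by (simp add: cnj_ve sum_distrib_left mult_ac)
    qed
    have I: "integrable ?\<mu> (\<lambda>t. complex_of_real (indicator C (?e t) * (norm (v (?e t)))\<^sup>2))"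
      unfolding eq using int[OF v] by (intro Bochner_Integration.integrable_sum) auto
    have "complex_of_real (LINT t|?\<mu>. indicator C (?e t) * (norm (v (?e t)))\<^sup>2) =
        (LINT t|?\<mu>. (\<Sum>n\<in>{-M..M}. b n * (indicator C (?e t) * v (?e t) * harmonic a (- n) t)))"
      unfolding eq[symmetric] by (rule integral_complex_of_real[symmetric])
    also have "\<dots> = (\<Sum>n\<in>{-M..M}. b n * L n v)"
      using int[OF v] by (simp add: L_def Bochner_Integration.integral_sum)
    also have "\<dots> = 0" using bL[OF v] .
    finally have "(LINT t|?\<mu>. indicator C (?e t) * (norm (v (?e t)))\<^sup>2) = 0"
      by (simp only: of_real_eq_0_iff)
    moreover have "integrable ?\<mu> (\<lambda>t. indicator C (?e t) * (norm (v (?e t)))\<^sup>2)"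
      using integrable_Re[OF I] by simp
    ultimately have "AE t in ?\<mu>. indicator C (?e t) * (norm (v (?e t)))\<^sup>2 = 0"
      by (subst (asm) integral_nonneg_eq_0_iff_AE) auto
    then have ae: "AE t in ?\<mu>. ?e t \<in> C \<longrightarrow> v (?e t) = 0"
      by eventually_elim (auto simp: indicator_def)
    define Z where "Z = {t\<in>{0..a}. v (?e t) = 0}"
    have "finite Z" unfolding Z_def ve
      using assms(1,4) by (intro finite_zeros_trig_sum[of _ m]) (auto simp: b_def)
    then have "emeasure lborel Z = 0" "Z \<in> sets lborel"
      by (auto simp: emeasure_lborel_countable countable_finite finite_imp_closed)
    moreover have "Z \<subseteq> {0..a}" by (auto simp: Z_def)
    ultimately have "Z \<in> null_sets ?\<mu>"
      by (simp add: null_sets_def circle_measure_def emeasure_restrict_space sets_restrict_space_iff)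
    then have "AE t in ?\<mu>. t \<notin> Z" by (rule AE_not_in)
    with ae have "AE t in ?\<mu>. \<not> ?e t \<in> C"
      using AE_space by eventually_elim (auto simp: Z_def)
    moreover have "{t \<in> {0..a}. ?e t \<in> C} \<in> sets ?\<mu>"
      by (auto simp: circle_measure_def sets_restrict_space_iff)
    ultimately show False
      using assms(3) AE_iff_measurable[of "{t \<in> {0..a}. ?e t \<in> C}" ?\<mu> "\<lambda>t. \<not> ?e t \<in> C"] by simp
  qed
  then obtain v where v: "v \<in> V" "\<And>n. n \<in> A \<Longrightarrow> L n v = 0" "L m v \<noteq> 0" by blast
  \<comment> \<open>The scaling gives the m-th integral the value \<open>a\<close>, that is, Fourier
    coefficient 1 for a measure of mass \<open>a\<close>.\<close>
  let ?w = "\<lambda>z. a / L m v * v z"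
  have Lw: "L n ?w = a / L m v * L n v" for n
    unfolding L_def integral_mult_right_zero[symmetric] by (simp add: mult_ac)
  show thesis
  proof (rule that[of ?w])
    show "continuous_on (sphere 0 1) ?w"
      using v(1,3) by (auto simp: V_def intro!: continuous_intros)
    show "(LINT t|?\<mu>. indicator C (?e t) * ?w (?e t) * harmonic a (- n) t) = (if n = m then a else 0)"
      if "\<bar>n\<bar> \<le> M" for n
    proof -
      have "n \<in> {-M..M}" using that by auto
      then have "n \<noteq> m \<Longrightarrow> L n v = 0" using v(2)[of n] by (simp add: A_def)
      then have "L n ?w = (if n = m then a else 0)" unfolding Lw using v(3) by simp
      then show ?thesis by (simp only: L_def)
    qed
  qed
qed

section \<open>Trigonometric sums that are small off a closed set\<close>

lemma trig_poly_coefficient_integral: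
  assumes "a > 0" "\<And>n. \<bar>n\<bar> > N \<Longrightarrow> b n = 0" "\<And>t. p t = (\<Sum>n\<in>{-N..N}. b n * harmonic a n t)"
  shows "(LINT t|circle_measure a. p t * harmonic a (- k) t) = a * b k"
proof -
  have "integrable (circle_measure a) (harmonic a n)" for n
    by (rule integrable_circle_bounded[where B = 1]) auto
  then have "(LINT t|circle_measure a. p t * harmonic a (- k) t) =
      (\<Sum>n\<in>{-N..N}. b n * (LINT t|circle_measure a. harmonic a (n - k) t))"
    by (simp add: assms(3) sum_distrib_right mult.assoc harmonic_mult Bochner_Integration.integral_sum)
  also have "\<dots> = (\<Sum>n\<in>{-N..N}. if n = k then a * b n else 0)"
    using assms(1) by (intro sum.cong) (auto simp: integral_harmonic)
  also have "\<dots> = a * b k"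
    using assms(2)[of k] by (cases "\<bar>k\<bar> > N") (auto simp: sum.delta)
  finally show ?thesis .
qed

text \<open>The cut-off biorthogonal function has the required low coefficients and vanishes off
  \<open>C\<close>. A trigonometric approximant \<open>p\<close> has nearly these coefficients;
  resetting them to the exact values costs little and yields the sum, which off \<open>C\<close> is
  only the approximation error.\<close>

lemma small_trig_sum_off_closed_set:
  assumes "a > 0" "closed C" "emeasure (circle_measure a) {t\<in>{0..a}. harmonic a 1 t \<in> C} \<noteq> 0"
    and "\<bar>m\<bar> \<le> M" "\<epsilon> > 0"
  obtains N b where "\<And>n. \<bar>n\<bar> > N \<Longrightarrow> b n = 0" "b m = 1" "\<And>n. \<bar>n\<bar> \<le> M \<Longrightarrow> n \<noteq> m \<Longrightarrow> b n = 0"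
    "(\<integral>\<^sup>+t. ennreal (indicator (- C) (harmonic a 1 t) * (norm (\<Sum>n\<in>{-N..N}. b n * harmonic a n t))\<^sup>2)
      \<partial>circle_measure a) \<le> ennreal \<epsilon>"
proof -
  let ?e = "harmonic a 1" and ?\<mu> = "circle_measure a"
  obtain v where v: "continuous_on (sphere 0 1) v" and
    orth: "\<And>n. \<bar>n\<bar> \<le> M \<Longrightarrow> (LINT t|?\<mu>. indicator C (?e t) * v (?e t) * harmonic a (- n) t) = (if n = m then a else 0)"
    using biorthogonal_function_on_circle[OF assms(1-4)] by blast
  have "C \<noteq> {}" using assms(3) by auto
  obtain B where B: "\<And>z. norm z = 1 \<Longrightarrow> norm (v z) \<le> B"
    using continuous_bounded_on_circle[OF v] by blast
  have "B \<ge> 0" using B[of 1] norm_ge_zero[of "v 1"] by (simp del: norm_ge_zero)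
  define J where "J = real_of_int (2 * M + 1)"
  have J: "J > 0" using assms(4) by (simp add: J_def)
  \<comment> \<open>A uniform bound for \<open>\<phi> - q\<close>: \<open>B + 1\<close> comes from
    the approximation, and \<open>J / a\<close> from correcting \<open>J\<close> coefficients by at
    most \<open>1 / a\<close> each.\<close>
  define D where "D = B + 1 + J / a"
  have D: "D > 0" using \<open>B \<ge> 0\<close> J assms(1) by (simp add: D_def add_pos_pos)
  \<comment> \<open>Chosen so that the final estimate \<open>D * (\<eta> + J * \<eta>)\<close> is at
    most \<open>\<epsilon>\<close>; the minimum with 1 is what makes \<open>D\<close> an admissible
    bound.\<close>
  define \<eta> where "\<eta> = min 1 (\<epsilon> / (D * (1 + J)))"
  have \<eta>: "\<eta> > 0" "\<eta> \<le> 1" using D J assms(5) by (auto simp: \<eta>_def)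
  have "\<eta> \<le> \<epsilon> / (D * (1 + J))" by (simp add: \<eta>_def)
  then have "\<eta> * (D * (1 + J)) \<le> \<epsilon>" using D J by (subst (asm) pos_le_divide_eq) auto
  then have \<eta>\<epsilon>: "D * (\<eta> + J * \<eta>) \<le> \<epsilon>" by (simp add: algebra_simps)
  define \<phi> where "\<phi> t = indicator C (?e t) * v (?e t)" for t
  obtain p where p: "p \<in> trig_poly a" "\<And>t. norm (\<phi> t - p t) \<le> B + 1" "(LINT t|?\<mu>. norm (\<phi> t - p t)) \<le> \<eta>"
    using trig_poly_L1_approx[OF assms(1,2) \<open>C \<noteq> {}\<close> v B \<eta>(1)] unfolding \<phi>_def by blast
  obtain N0 b0 where b0: "\<And>n. \<bar>n\<bar> > N0 \<Longrightarrow> b0 n = 0" "\<And>t. p t = (\<Sum>n\<in>{-N0..N0}. b0 n * harmonic a n t)"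
    using trig_poly_coefficients[OF p(1)] by blast
  have [measurable]: "p \<in> borel_measurable borel" "C \<in> sets borel" "(\<lambda>t. v (?e t)) \<in> borel_measurable borel"
    using p(1) assms(2) v by (auto intro: borel_measurable_compose_harmonic)
  have [measurable]: "\<phi> \<in> borel_measurable borel" unfolding \<phi>_def by measurable
  \<comment> \<open>The error in the low coefficients. Since \<open>\<phi>\<close> has exactly the
    desired ones, \<open>a * \<kappa> n\<close> is a coefficient integral of
    \<open>p - \<phi>\<close> and is controlled by the L1 error.\<close>
  define \<kappa> where "\<kappa> n = b0 n - (if n = m then 1 else 0)" for n
  have intd: "integrable ?\<mu> (\<lambda>t. norm (\<phi> t - p t))"
    using p(2) by (intro integrable_circle_bounded[where B = "B + 1"]) auto
  have \<kappa>: "norm (\<kappa> n) \<le> \<eta> / a" if n: "\<bar>n\<bar> \<le> M" for n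
  proof -
    have i1: "integrable ?\<mu> (\<lambda>t. \<phi> t * harmonic a (- n) t)"
      unfolding \<phi>_def using integrable_circle_cutoff[OF v assms(2)] .
    obtain Bp where "\<And>t. norm (p t) \<le> Bp" using bounded_trig_poly[OF p(1)] by blast
    then have i2: "integrable ?\<mu> (\<lambda>t. p t * harmonic a (- n) t)"
      by (intro integrable_circle_bounded[where B = Bp]) (auto simp: norm_mult)
    have "a * \<kappa> n = (LINT t|?\<mu>. p t * harmonic a (- n) t) - (LINT t|?\<mu>. \<phi> t * harmonic a (- n) t)"
      using orth[OF n] trig_poly_coefficient_integral[OF assms(1) b0, of n]
      by (auto simp: \<kappa>_def \<phi>_def algebra_simps)
    also have "\<dots> = (LINT t|?\<mu>. (p t - \<phi> t) * harmonic a (- n) t)"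
      using i1 i2 by (simp add: left_diff_distrib)
    finally have "a * norm (\<kappa> n) = norm (LINT t|?\<mu>. (p t - \<phi> t) * harmonic a (- n) t)"
      using assms(1) by (metis abs_of_pos norm_mult norm_of_real)
    also have "\<dots> \<le> (LINT t|?\<mu>. norm ((p t - \<phi> t) * harmonic a (- n) t))"
      by (rule integral_norm_bound)
    also have "\<dots> \<le> \<eta>" using p(3) by (simp add: norm_mult norm_minus_commute)
    finally show ?thesis using assms(1) by (simp add: field_simps)
  qed
  define N where "N = max N0 M"
  define b where "b n = (if \<bar>n\<bar> \<le> M then (if n = m then 1 else 0) else b0 n)" for n
  define q where "q t = (\<Sum>n\<in>{-N..N}. b n * harmonic a n t)" for t
  have b_top: "b n = 0" if "\<bar>n\<bar> > N" for n
    using b0(1)[of n] that by (auto simp: b_def N_def)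
  have [measurable]: "q \<in> borel_measurable borel" unfolding q_def by measurable
  have q: "p t - q t = (\<Sum>n\<in>{-M..M}. \<kappa> n * harmonic a n t)" for t
  proof -
    have "p t = (\<Sum>n\<in>{-N..N}. b0 n * harmonic a n t)"
      unfolding b0(2) by (rule trig_sum_extend[symmetric]) (use b0(1) in \<open>auto simp: N_def\<close>)
    then have "p t - q t = (\<Sum>n\<in>{-N..N}. (if \<bar>n\<bar> \<le> M then \<kappa> n else 0) * harmonic a n t)"
      by (simp only: q_def sum_subtractf[symmetric]) (intro sum.cong, auto simp: b_def \<kappa>_def algebra_simps)
    also have "\<dots> = (\<Sum>n\<in>{-M..M}. (if \<bar>n\<bar> \<le> M then \<kappa> n else 0) * harmonic a n t)"
      by (rule trig_sum_extend) (auto simp: N_def)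
    also have "\<dots> = (\<Sum>n\<in>{-M..M}. \<kappa> n * harmonic a n t)"
      by (intro sum.cong) auto
    finally show ?thesis .
  qed
  have pq: "norm (p t - q t) \<le> J * (\<eta> / a)" for t
  proof -
    have "norm (p t - q t) \<le> (\<Sum>n\<in>{-M..M}. norm (\<kappa> n))"
      unfolding q by (rule sum_norm_le[THEN order_trans]) (auto simp: norm_mult)
    also have "\<dots> \<le> (\<Sum>n\<in>{-M..M}. \<eta> / a)" using \<kappa> by (intro sum_mono) auto
    also have "\<dots> = J * (\<eta> / a)" using assms(4) by (simp add: J_def)
    finally show ?thesis .
  qed
  have tri: "norm (\<phi> t - q t) \<le> norm (\<phi> t - p t) + J * (\<eta> / a)" for t
    using norm_triangle_ineq[of "\<phi> t - p t" "p t - q t"] pq[of t] by simp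
  have "J * (\<eta> / a) \<le> J * (1 / a)"
    using \<eta> J assms(1) by (intro mult_left_mono divide_right_mono) auto
  then have bd: "norm (\<phi> t - q t) \<le> D" for t
    using tri[of t] p(2)[of t] by (simp add: D_def)
  have "(\<integral>\<^sup>+t. ennreal (indicator (- C) (?e t) * (norm (q t))\<^sup>2) \<partial>?\<mu>)
      \<le> (\<integral>\<^sup>+t. ennreal (D * (norm (\<phi> t - p t) + J * (\<eta> / a))) \<partial>?\<mu>)"
  proof (intro nn_integral_mono ennreal_leI)
    fix t
    \<comment> \<open>Off \<open>C\<close> the function \<open>\<phi>\<close> is zero. One factor of
      the square is then bounded by \<open>D\<close> and the other kept, so the L1 estimate
      suffices.\<close>
    have "indicator (- C) (?e t) * (norm (q t))\<^sup>2 \<le> (norm (\<phi> t - q t))\<^sup>2"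
      by (auto simp: indicator_def \<phi>_def)
    also have "\<dots> \<le> D * (norm (\<phi> t - p t) + J * (\<eta> / a))"
      unfolding power2_eq_square using bd tri D by (intro mult_mono) auto
    finally show "indicator (- C) (?e t) * (norm (q t))\<^sup>2 \<le> D * (norm (\<phi> t - p t) + J * (\<eta> / a))" .
  qed
  also have "\<dots> = ennreal (LINT t|?\<mu>. D * (norm (\<phi> t - p t) + J * (\<eta> / a)))"
  proof (rule nn_integral_eq_integral)
    have "integrable ?\<mu> (\<lambda>t. J * (\<eta> / a))"
      by (rule integrable_circle_bounded[where B = "\<bar>J * (\<eta> / a)\<bar>"]) auto
    then show "integrable ?\<mu> (\<lambda>t. D * (norm (\<phi> t - p t) + J * (\<eta> / a)))"
      using intd by auto
  qed (use D J \<eta> assms(1) in auto)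
  also have "(LINT t|?\<mu>. D * (norm (\<phi> t - p t) + J * (\<eta> / a))) = D * ((LINT t|?\<mu>. norm (\<phi> t - p t)) + J * \<eta>)"
  proof -
    have "integrable ?\<mu> (\<lambda>t. J * (\<eta> / a))"
      by (rule integrable_circle_bounded[where B = "\<bar>J * (\<eta> / a)\<bar>"]) auto
    then have "(LINT t|?\<mu>. norm (\<phi> t - p t) + J * (\<eta> / a)) = (LINT t|?\<mu>. norm (\<phi> t - p t)) + J * \<eta>"
      using intd assms(1) by (subst Bochner_Integration.integral_add) (auto simp: measure_space_circle)
    then show ?thesis by (simp only: integral_mult_right_zero)
  qed
  also have "\<dots> \<le> D * (\<eta> + J * \<eta>)" using p(3) D by (intro mult_left_mono) auto
  also have "\<dots> \<le> \<epsilon>" by fact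
  finally have "(\<integral>\<^sup>+t. ennreal (indicator (- C) (?e t) * (norm (q t))\<^sup>2) \<partial>?\<mu>) \<le> ennreal \<epsilon>"
    by (simp add: ennreal_leI)
  then show thesis
    using b_top assms(4) by (intro that[of N b]) (auto simp: q_def b_def N_def)
qed

text \<open>By duality, a function that vanishes on \<open>C\<close> and has no Fourier coefficients in
  \<open>M < \<bar>n\<bar> \<le> N\<close> has only small coefficients for \<open>\<bar>n\<bar> \<le> M\<close>.\<close>

definition gap_approximable :: "real \<Rightarrow> complex set \<Rightarrow> real \<Rightarrow> int \<Rightarrow> int \<Rightarrow> bool" where
  "gap_approximable a C \<epsilon> M N \<longleftrightarrow> M < N \<and> (\<forall>m. \<bar>m\<bar> \<le> M \<longrightarrow> (\<exists>b.
     b m = 1 \<and> (\<forall>n. \<bar>n\<bar> \<le> M \<longrightarrow> n \<noteq> m \<longrightarrow> b n = 0) \<and>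
     (\<integral>\<^sup>+t. ennreal (indicator (- C) (harmonic a 1 t) * (norm (\<Sum>n\<in>{-N..N}. b n * harmonic a n t))\<^sup>2)
        \<partial>circle_measure a) \<le> ennreal \<epsilon>))"

text \<open>Only finitely many \<open>m\<close> occur, and enlarging \<open>N\<close> leaves each
  sum unchanged because its coefficients vanish beyond the old bound; so a maximum works for all
  \<open>m\<close> at once.\<close>

lemma gap_approximable_exists:
  assumes "a > 0" "closed C" "emeasure (circle_measure a) {t\<in>{0..a}. harmonic a 1 t \<in> C} \<noteq> 0" "\<epsilon> > 0"
  obtains N where "gap_approximable a C \<epsilon> M N"
proof -
  let ?J = "\<lambda>N b. \<integral>\<^sup>+t. ennreal (indicator (- C) (harmonic a 1 t) * (norm (\<Sum>n\<in>{-N..N}. b n * harmonic a n t))\<^sup>2)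
        \<partial>circle_measure a"
  define P where "P m N b \<longleftrightarrow> (\<forall>n. \<bar>n\<bar> > N \<longrightarrow> b n = 0) \<and> b m = 1 \<and>
      (\<forall>n. \<bar>n\<bar> \<le> M \<longrightarrow> n \<noteq> m \<longrightarrow> b n = 0) \<and> ?J N b \<le> ennreal \<epsilon>" for m N :: int and b
  have "\<exists>N b. P m N b" if m: "\<bar>m\<bar> \<le> M" for m
  proof -
    obtain N b where "\<And>n. \<bar>n\<bar> > N \<Longrightarrow> b n = 0" "b m = 1"
      "\<And>n. \<bar>n\<bar> \<le> M \<Longrightarrow> n \<noteq> m \<Longrightarrow> b n = 0" "?J N b \<le> ennreal \<epsilon>"
      using small_trig_sum_off_closed_set[OF assms(1-3) m assms(4)] by blast
    then have "P m N b" unfolding P_def by blast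
    then show ?thesis by blast
  qed
  then obtain N where N: "\<And>m. \<bar>m\<bar> \<le> M \<Longrightarrow> \<exists>b. P m (N m) b" by metis
  \<comment> \<open>Inserting \<open>M + 1\<close> makes the bound strictly larger than
    \<open>M\<close> and keeps the set nonempty even for negative \<open>M\<close>.\<close>
  define L where "L = Max (insert (M + 1) (N ` {-M..M}))"
  have "L \<ge> M + 1" unfolding L_def by (intro Max_ge) auto
  have "\<exists>b. b m = 1 \<and> (\<forall>n. \<bar>n\<bar> \<le> M \<longrightarrow> n \<noteq> m \<longrightarrow> b n = 0) \<and> ?J L b \<le> ennreal \<epsilon>"
    if m: "\<bar>m\<bar> \<le> M" for m
  proof -
    have "m \<in> {-M..M}" using m by auto
    then have "N m \<le> L" unfolding L_def by (intro Max_ge) auto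
    moreover obtain b where b: "P m (N m) b" using N[OF m] by blast
    ultimately have "?J L b = ?J (N m) b"
      using trig_sum_extend[of "N m" b L] by (simp add: P_def)
    then show ?thesis using b unfolding P_def by auto
  qed
  then have "gap_approximable a C \<epsilon> M L"
    unfolding gap_approximable_def using \<open>L \<ge> M + 1\<close> by simp
  then show thesis by (rule that)
qed

section \<open>A closed set of positive measure missed by the spectrum\<close>

text \<open>The trace leaves a part of \<open>{0..a}\<close> of positive measure, which by inner
  regularity contains a compact set of positive measure. The image of the latter under the covering
  map is closed and is missed by \<open>S\<close>.\<close>

lemma periodized_trace_avoiding_closed_set:
  assumes "S \<in> sets lebesgue" "a > 0" "emeasure lebesgue (periodized_trace S a) < ennreal a"
  obtains C where "closed C" "emeasure (circle_measure a) {t\<in>{0..a}. harmonic a 1 t \<in> C} \<noteq> 0"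
    "\<And>t. t \<in> S \<Longrightarrow> harmonic a 1 t \<notin> C"
proof -
  let ?P = "periodized_trace S a"
  \<comment> \<open>Measurability of the trace: the periodization is a countable union of
    translates.\<close>
  have "{y. \<exists>s\<in>S. \<exists>k::int. y = s + a * of_int k} = (\<Union>k::int. (+) (a * of_int k) ` S)"
    by (auto simp: image_iff add.commute)
  moreover have "(+) c ` S \<in> sets lebesgue" for c
    using assms(1) by (rule lebesgue_sets_translation)
  ultimately have P: "?P \<in> sets lebesgue" unfolding periodized_trace_def by auto
  have P_sub: "?P \<subseteq> {0..a}" by (auto simp: periodized_trace_def)
  define G where "G = {0..a} - ?P"
  have G: "G \<in> sets lebesgue" unfolding G_def using P by (intro sets.Diff) auto
  have "emeasure lebesgue ?P + emeasure lebesgue G = emeasure lebesgue {0..a}"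
    using plus_emeasure[OF P G] P_sub by (simp add: G_def Un_absorb1)
  then have "emeasure lebesgue ?P + emeasure lebesgue G = ennreal a" using assms(2) by simp
  with assms(3) have G0: "emeasure lebesgue G \<noteq> 0" by auto
  have "emeasure lebesgue G \<le> emeasure lebesgue {0..a}" by (intro emeasure_mono) (auto simp: G_def)
  then obtain x where x: "0 \<le> x" "emeasure lebesgue G = ennreal x"
    using assms(2) by (cases "emeasure lebesgue G") (auto simp: top_unique)
  \<comment> \<open>Half the measure of \<open>G\<close>: removing a set of measure below
    \<open>e\<close> cannot exhaust \<open>G\<close>.\<close>
  define e where "e = x / 2"
  have e: "0 < e" "ennreal e < emeasure lebesgue G"
    using x G0 by (auto simp: e_def ennreal_less_iff less_le)
  obtain T where T: "closed T" "T \<subseteq> G" "G - T \<in> lmeasurable" "emeasure lebesgue (G - T) < ennreal e"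
    using sets_lebesgue_inner_closed[OF G e(1)] by blast
  have "emeasure lebesgue T \<noteq> 0"
  proof
    assume 0: "emeasure lebesgue T = 0"
    have "emeasure lebesgue G \<le> emeasure lebesgue (G - T) + emeasure lebesgue T"
      using T G by (intro order_trans[OF _ emeasure_subadditive] emeasure_mono) (auto intro: fmeasurableD)
    then show False using 0 T(4) e(2) by simp
  qed
  have "compact T" using T(1,2) by (auto simp: compact_eq_bounded_closed G_def intro: bounded_subset[of "{0..a}"])
  define C where "C = harmonic a 1 ` T"
  have C: "closed C" unfolding C_def using \<open>compact T\<close>
    by (intro compact_imp_closed compact_continuous_image continuous_intros)
  show thesis
  proof (rule that[OF C])
    have Tsub: "T \<subseteq> {t\<in>{0..a}. harmonic a 1 t \<in> C}" using T(2) by (auto simp: G_def C_def)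
    have [measurable]: "C \<in> sets borel" using C by simp
    have m: "{t\<in>{0..a}. harmonic a 1 t \<in> C} \<in> sets borel" by measurable
    have "emeasure lborel T \<noteq> 0"
      using \<open>emeasure lebesgue T \<noteq> 0\<close> T(1) by (simp add: emeasure_completion)
    moreover have "emeasure lborel T \<le> emeasure lborel {t\<in>{0..a}. harmonic a 1 t \<in> C}"
      using Tsub m by (intro emeasure_mono) auto
    ultimately have "emeasure lborel {t\<in>{0..a}. harmonic a 1 t \<in> C} \<noteq> 0" by auto
    moreover have "{t\<in>{0..a}. harmonic a 1 t \<in> C} \<subseteq> {0..a}" by blast
    ultimately show "emeasure (circle_measure a) {t\<in>{0..a}. harmonic a 1 t \<in> C} \<noteq> 0"
      unfolding circle_measure_def by (subst emeasure_restrict_space) auto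
    show "harmonic a 1 t \<notin> C" if "t \<in> S" for t
    proof
      assume "harmonic a 1 t \<in> C"
      then obtain s where s: "s \<in> T" "harmonic a 1 s = harmonic a 1 t" by (auto simp: C_def)
      then obtain k :: int where "s = t + a * of_int k" using harmonic_eq_iff[OF assms(2)] by blast
      then have "s \<in> ?P" using that s(1) T(2) by (auto simp: periodized_trace_def G_def)
      then show False using s(1) T(2) by (auto simp: G_def)
    qed
  qed
qed

section \<open>Estimates for functions in the Sobolev space\<close>

lemma nn_integral_circle:
  assumes "u \<in> borel_measurable borel"
  shows "(\<integral>\<^sup>+t. u t \<partial>circle_measure a) = (\<integral>\<^sup>+t. u t * indicator {0..a} t \<partial>lborel)"
  unfolding circle_measure_def by (subst nn_integral_restrict_space) auto

lemma nn_integral_period: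
  fixes u :: "real \<Rightarrow> ennreal"
  assumes [measurable]: "u \<in> borel_measurable borel" and per: "\<And>t k. u (t + a * of_int k) = u t"
  shows "(\<integral>\<^sup>+t. u t * indicator {a * of_int k..a * of_int k + a} t \<partial>lborel) = (\<integral>\<^sup>+t. u t \<partial>circle_measure a)"
proof -
  have "(\<integral>\<^sup>+t. u t * indicator {a * of_int k..a * of_int k + a} t \<partial>lborel) =
      (\<integral>\<^sup>+t. u (t + a * of_int k) * indicator {a * of_int k..a * of_int k + a} (t + a * of_int k) \<partial>lborel)"
    using nn_integral_real_affine[of "\<lambda>t. u t * indicator {a * of_int k..a * of_int k + a} t" 1 "a * of_int k"]
    by (simp add: add.commute)
  also have "\<dots> = (\<integral>\<^sup>+t. u t * indicator {0..a} t \<partial>lborel)"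
    by (intro nn_integral_cong arg_cong2[where f = "(*)"]) (auto simp: per indicator_def)
  finally show ?thesis by (simp add: nn_integral_circle)
qed

text \<open>The line is cut into periods, each contributing the same integral of \<open>u\<close>
  times a bound for the weight there. These bounds are summable since \<open>2 * \<alpha>\<close>
  exceeds 1, and \<open>K\<close> does not depend on \<open>u\<close>.\<close>

lemma periodic_weighted_integral_bound:
  assumes "a > 0" "\<alpha> > 1 / 2"
  obtains K :: real where "K \<ge> 0"
    "\<And>u. u \<in> borel_measurable borel \<Longrightarrow> (\<And>t k. u (t + a * of_int k) = u t) \<Longrightarrow>
      (\<integral>\<^sup>+t. u t * ennreal (1 / (1 + \<bar>t\<bar> powr (2 * \<alpha>))) \<partial>lborel) \<le> ennreal K * (\<integral>\<^sup>+t. u t \<partial>circle_measure a)"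
proof -
  \<comment> \<open>A bound for the weight on the two periods starting at distance
    \<open>a * k\<close> from the origin, one on each side.\<close>
  define c where "c k = 1 / (1 + (a * real k) powr (2 * \<alpha>))" for k :: nat
  have c0: "c k \<ge> 0" for k by (simp add: c_def)
  have sm: "summable c"
  proof (rule summable_comparison_test)
    have "norm (c n) \<le> a powr (- (2 * \<alpha>)) * real n powr (- (2 * \<alpha>))" if "n \<ge> 1" for n
    proof -
      have "(a * real n) powr (2 * \<alpha>) > 0" using that assms by simp
      then have "c n \<le> 1 / (a * real n) powr (2 * \<alpha>)"
        unfolding c_def by (intro divide_left_mono mult_pos_pos add_pos_pos) auto
      also have "\<dots> = a powr (- (2 * \<alpha>)) * real n powr (- (2 * \<alpha>))"
        using assms by (simp add: powr_mult powr_minus field_simps)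
      finally show ?thesis using c0[of n] by simp
    qed
    then show "\<exists>N. \<forall>n\<ge>N. norm (c n) \<le> a powr (- (2 * \<alpha>)) * real n powr (- (2 * \<alpha>))" by blast
    show "summable (\<lambda>n. a powr (- (2 * \<alpha>)) * real n powr (- (2 * \<alpha>)))"
      using assms by (intro summable_mult) (simp add: summable_real_powr_iff)
  qed
  define I where "I k = {a * of_int k..a * of_int k + a}" for k :: int
  have I_meas [measurable]: "I k \<in> sets borel" for k by (simp add: I_def)
  have w: "ennreal (1 / (1 + \<bar>t\<bar> powr (2 * \<alpha>))) \<le>
      (\<Sum>k. ennreal (c k) * (indicator (I (int k)) t + indicator (I (- int k - 1)) t))" for t
  proof -
    define k where "k = nat \<lfloor>\<bar>t\<bar> / a\<rfloor>"
    have k: "real k = of_int \<lfloor>\<bar>t\<bar> / a\<rfloor>" using assms(1) by (simp add: k_def)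
    have "real k \<le> \<bar>t\<bar> / a" "\<bar>t\<bar> / a < real k + 1" unfolding k by linarith+
    then have k2: "a * real k \<le> \<bar>t\<bar>" "\<bar>t\<bar> \<le> a * real k + a"
      using assms(1) by (auto simp: field_simps)
    have "1 / (1 + \<bar>t\<bar> powr (2 * \<alpha>)) \<le> c k"
      unfolding c_def using k2 assms by (intro divide_left_mono add_left_mono powr_mono2 mult_pos_pos add_pos_nonneg) auto
    moreover have "t \<in> I (int k) \<or> t \<in> I (- int k - 1)"
      using k2 by (cases "t \<ge> 0") (auto simp: I_def algebra_simps)
    then have "1 \<le> (indicator (I (int k)) t + indicator (I (- int k - 1)) t :: ennreal)"
      by (auto simp: indicator_def)
    ultimately have "ennreal (1 / (1 + \<bar>t\<bar> powr (2 * \<alpha>))) * 1 \<le>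
        ennreal (c k) * (indicator (I (int k)) t + indicator (I (- int k - 1)) t)"
      by (intro mult_mono ennreal_leI) auto
    also have "\<dots> = (\<Sum>k\<in>{k}. ennreal (c k) * (indicator (I (int k)) t + indicator (I (- int k - 1)) t))"
      by simp
    also have "\<dots> \<le> (\<Sum>k. ennreal (c k) * (indicator (I (int k)) t + indicator (I (- int k - 1)) t))"
      by (intro sum_le_suminf) auto
    finally show ?thesis by simp
  qed
  show thesis
  proof (rule that[of "2 * suminf c"])
    show "0 \<le> 2 * suminf c" using suminf_nonneg[OF sm c0] by simp
    fix u :: "real \<Rightarrow> ennreal"
    assume [measurable]: "u \<in> borel_measurable borel" and per: "\<And>t k. u (t + a * of_int k) = u t"
    let ?U = "\<integral>\<^sup>+t. u t \<partial>circle_measure a"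
    have period: "(\<integral>\<^sup>+t. u t * indicator (I k) t \<partial>lborel) = ?U" for k
      unfolding I_def by (rule nn_integral_period) (use per in auto)
    have "(\<integral>\<^sup>+t. u t * ennreal (1 / (1 + \<bar>t\<bar> powr (2 * \<alpha>))) \<partial>lborel) \<le>
        (\<integral>\<^sup>+t. (\<Sum>k. ennreal (c k) * (u t * indicator (I (int k)) t + u t * indicator (I (- int k - 1)) t)) \<partial>lborel)"
    proof (rule nn_integral_mono)
      fix t
      have "u t * ennreal (1 / (1 + \<bar>t\<bar> powr (2 * \<alpha>))) \<le>
        u t * (\<Sum>k. ennreal (c k) * (indicator (I (int k)) t + indicator (I (- int k - 1)) t))"
        using w by (intro mult_left_mono) auto
      then show "u t * ennreal (1 / (1 + \<bar>t\<bar> powr (2 * \<alpha>))) \<le>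
        (\<Sum>k. ennreal (c k) * (u t * indicator (I (int k)) t + u t * indicator (I (- int k - 1)) t))"
        by (simp add: ennreal_suminf_cmult[symmetric] ring_distribs mult_ac)
    qed
    also have "\<dots> = (\<Sum>k. \<integral>\<^sup>+t. ennreal (c k) * (u t * indicator (I (int k)) t + u t * indicator (I (- int k - 1)) t) \<partial>lborel)"
      by (rule nn_integral_suminf) measurable
    also have "\<dots> = (\<Sum>k. ennreal (c k) * (2 * ?U))"
    proof (intro suminf_cong)
      fix k
      have "(\<integral>\<^sup>+t. ennreal (c k) * (u t * indicator (I (int k)) t + u t * indicator (I (- int k - 1)) t) \<partial>lborel) =
        ennreal (c k) * ((\<integral>\<^sup>+t. u t * indicator (I (int k)) t \<partial>lborel) + (\<integral>\<^sup>+t. u t * indicator (I (- int k - 1)) t \<partial>lborel))"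
        by (simp add: nn_integral_cmult nn_integral_add)
      then show "(\<integral>\<^sup>+t. ennreal (c k) * (u t * indicator (I (int k)) t + u t * indicator (I (- int k - 1)) t) \<partial>lborel) =
        ennreal (c k) * (2 * ?U)"
        by (simp only: period mult_2)
    qed
    also have "\<dots> = (\<Sum>k. ennreal (c k)) * (2 * ?U)" by simp
    also have "(\<Sum>k. ennreal (c k)) = ennreal (suminf c)"
      using suminf_ennreal2[OF c0 sm] by simp
    also have "ennreal (suminf c) * (2 * ?U) = ennreal (2 * suminf c) * ?U"
      using suminf_nonneg[OF sm c0] by (simp add: ennreal_mult mult_ac)
    finally show "(\<integral>\<^sup>+t. u t * ennreal (1 / (1 + \<bar>t\<bar> powr (2 * \<alpha>))) \<partial>lborel) \<le> ennreal (2 * suminf c) * ?U" .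
  qed
qed

section \<open>Integrability and estimates for samples\<close>

lemma weighted_AM_GM:
  fixes x y r :: real
  assumes "r > 0"
  shows "x * y \<le> (r * x\<^sup>2 + y\<^sup>2 / r) / 2"
proof -
  have "0 \<le> (r * x - y)\<^sup>2 / r" using assms by simp
  also have "\<dots> = r * x\<^sup>2 + y\<^sup>2 / r - 2 * (x * y)"
    using assms by (simp add: power2_eq_square field_simps)
  finally show ?thesis by simp
qed

text \<open>By AM-GM, \<open>F\<close> is dominated by the reciprocal weight plus the weighted
  square. The reciprocal weight is integrable by the periodic bound for period 1 and constant
  \<open>u = 1\<close>.\<close>

lemma integrable_of_weighted_square:
  fixes F :: "real \<Rightarrow> complex"
  assumes "\<alpha> > 1 / 2" "F \<in> borel_measurable lebesgue"
    and "integrable lebesgue (\<lambda>t. (1 + \<bar>t\<bar> powr (2 * \<alpha>)) * (norm (F t))\<^sup>2)"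
  shows "integrable lebesgue F"
proof -
  let ?w = "\<lambda>t::real. 1 / (1 + \<bar>t\<bar> powr (2 * \<alpha>))"
  obtain K :: real where K: "K \<ge> 0" "\<And>u. u \<in> borel_measurable borel \<Longrightarrow> (\<And>t k. u (t + 1 * of_int k) = u t) \<Longrightarrow>
      (\<integral>\<^sup>+t. u t * ennreal (?w t) \<partial>lborel) \<le> ennreal K * (\<integral>\<^sup>+t. u t \<partial>circle_measure 1)"
    using periodic_weighted_integral_bound[OF zero_less_one assms(1)] by blast
  have "(\<integral>\<^sup>+t. 1 * ennreal (?w t) \<partial>lborel) \<le> ennreal K * (\<integral>\<^sup>+t. 1 \<partial>circle_measure 1)"
    by (rule K(2)) auto
  also have "(\<integral>\<^sup>+t. 1 \<partial>circle_measure 1) = 1"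
    using nn_integral_circle[of "\<lambda>_. 1" 1] by simp
  finally have "(\<integral>\<^sup>+t. ennreal (norm (?w t)) \<partial>lborel) < \<infinity>"
    by (simp add: order_le_less_trans[OF _ ennreal_less_top])
  then have "integrable lborel ?w" by (intro integrableI_bounded) auto
  then have w: "integrable lebesgue ?w" by (subst integrable_completion) auto
  show ?thesis
  proof (rule Bochner_Integration.integrable_bound[OF Bochner_Integration.integrable_add[OF w assms(3)] assms(2)], rule AE_I2)
    fix t :: real
    define g where "g = 1 + \<bar>t\<bar> powr (2 * \<alpha>)"
    have g: "g > 0" by (simp add: g_def add_pos_nonneg)
    have "norm (F t) \<le> (1 / g + g * (norm (F t))\<^sup>2) / 2"
      using weighted_AM_GM[of "1 / g" 1 "norm (F t)"] g by (simp add: mult.commute)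
    also have "\<dots> \<le> 1 / g + g * (norm (F t))\<^sup>2"
    proof -
      have "0 \<le> 1 / g + g * (norm (F t))\<^sup>2" using g by (intro add_nonneg_nonneg) auto
      moreover have "x / 2 \<le> x" if "0 \<le> x" for x :: real using that by simp
      ultimately show ?thesis by blast
    qed
    finally show "norm (F t) \<le> norm (?w t + (1 + \<bar>t\<bar> powr (2 * \<alpha>)) * (norm (F t))\<^sup>2)"
      unfolding g_def by simp
  qed
qed

text \<open>A combination of samples is the integral of \<open>F\<close> against a trigonometric
  polynomial, of which only the part off \<open>C\<close> matters. AM-GM with a free parameter
  \<open>s\<close> replaces Cauchy-Schwarz. The constant may depend on \<open>f\<close>, but is
  uniform in the polynomial and in the shift \<open>\<delta>\<close>.\<close>

lemma W_space_value_estimate: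
  fixes F :: "real \<Rightarrow> complex"
  assumes a: "a > 0" and \<alpha>: "\<alpha> > 1 / 2" and F: "F \<in> borel_measurable lebesgue"
    and intF: "integrable lebesgue (\<lambda>t. (1 + \<bar>t\<bar> powr (2 * \<alpha>)) * (norm (F t))\<^sup>2)"
    and f: "\<And>x. f x = (LINT t|lebesgue. exp (complex_of_real (2 * pi * t * x) * \<i>) * F t)"
    and supp: "AE t in lebesgue. harmonic a 1 t \<in> C \<longrightarrow> F t = 0" and C: "closed C"
  shows "\<exists>K. \<forall>N b s \<epsilon> \<delta>. s > 0 \<longrightarrow> \<epsilon> > 0 \<longrightarrow>
      (\<integral>\<^sup>+t. ennreal (indicator (- C) (harmonic a 1 t) * (norm (\<Sum>n\<in>{-N..N}. b n * harmonic a n t))\<^sup>2)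
        \<partial>circle_measure a) \<le> ennreal \<epsilon> \<longrightarrow>
      norm (\<Sum>n\<in>{-N..N}. b n * f ((of_int n + \<delta>) / a)) \<le> K * (s * \<epsilon> + 1 / s)"
proof -
  let ?e = "harmonic a 1"
  have F1: "integrable lebesgue F" using integrable_of_weighted_square[OF \<alpha> F intF] .
  obtain K :: real where K: "K \<ge> 0" "\<And>u. u \<in> borel_measurable borel \<Longrightarrow> (\<And>t k. u (t + a * of_int k) = u t) \<Longrightarrow>
      (\<integral>\<^sup>+t. u t * ennreal (1 / (1 + \<bar>t\<bar> powr (2 * \<alpha>))) \<partial>lborel) \<le> ennreal K * (\<integral>\<^sup>+t. u t \<partial>circle_measure a)"
    using periodic_weighted_integral_bound[OF a \<alpha>] by blast
  define g where "g t = 1 + \<bar>t\<bar> powr (2 * \<alpha>)" for t :: real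
  have g: "g t > 0" for t by (simp add: g_def add_pos_nonneg)
  have [measurable]: "g \<in> borel_measurable borel" unfolding g_def by measurable
  define I where "I = (LINT t|lebesgue. g t * (norm (F t))\<^sup>2)"
  have I0: "I \<ge> 0" unfolding I_def using less_imp_le[OF g] by (intro integral_nonneg_AE AE_I2 mult_nonneg_nonneg) auto
  have [measurable]: "C \<in> sets borel" using C by simp
  show ?thesis
  proof (intro exI[of _ "K + I"] allI impI)
    fix N :: int and b s \<epsilon> \<delta>
    define p where "p t = (\<Sum>n\<in>{-N..N}. b n * harmonic a n t)" for t
    assume s: "(s::real) > 0" and \<epsilon>: "(\<epsilon>::real) > 0" and
      "(\<integral>\<^sup>+t. ennreal (indicator (- C) (?e t) * (norm (\<Sum>n\<in>{-N..N}. b n * harmonic a n t))\<^sup>2)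
        \<partial>circle_measure a) \<le> ennreal \<epsilon>"
    then have small: "(\<integral>\<^sup>+t. ennreal (indicator (- C) (?e t) * (norm (p t))\<^sup>2) \<partial>circle_measure a) \<le> ennreal \<epsilon>"
      by (simp add: p_def)
    have [measurable]: "p \<in> borel_measurable borel" unfolding p_def by measurable
    define u where "u t = ennreal (indicator (- C) (?e t) * (norm (p t))\<^sup>2)" for t
    have [measurable]: "u \<in> borel_measurable borel" unfolding u_def by measurable
    have "u (t + a * of_int k) = u t" for t k
      by (simp add: u_def p_def harmonic_periodic[OF a])
    then have "(\<integral>\<^sup>+t. u t * ennreal (1 / g t) \<partial>lborel) \<le> ennreal K * (\<integral>\<^sup>+t. u t \<partial>circle_measure a)"
      unfolding g_def by (intro K(2)) auto
    also have "\<dots> \<le> ennreal K * ennreal \<epsilon>"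
      using small by (intro mult_left_mono) (auto simp: u_def)
    finally have U: "(\<integral>\<^sup>+t. u t * ennreal (1 / g t) \<partial>lebesgue) \<le> ennreal (K * \<epsilon>)"
      using K(1) \<epsilon> by (simp add: nn_integral_completion ennreal_mult)
    \<comment> \<open>The factor caused by the shift: the same for all \<open>n\<close> and of
      modulus 1, so \<open>\<delta>\<close> drops out of every estimate.\<close>
    define c where "c t = cis (2 * pi * t * \<delta> / a)" for t
    have split: "exp (complex_of_real (2 * pi * t * ((of_int n + \<delta>) / a)) * \<i>) = harmonic a n t * c t" for t n
    proof -
      have "exp (complex_of_real (2 * pi * t * ((of_int n + \<delta>) / a)) * \<i>) = cis (2 * pi * t * ((of_int n + \<delta>) / a))"
        by (simp add: cis_conv_exp mult.commute)
      also have "\<dots> = cis (of_int n * (2 * pi * t / a) + 2 * pi * t * \<delta> / a)"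
        by (simp add: algebra_simps add_divide_distrib)
      finally show ?thesis by (simp only: harmonic_def c_def cis_mult)
    qed
    have cmeas [measurable]: "c \<in> borel_measurable borel"
      unfolding c_def divide_inverse by (intro borel_measurable_continuous_onI continuous_intros)
    have cn: "norm (c t) = 1" for t by (simp add: c_def)
    have hF: "integrable lebesgue (\<lambda>t. harmonic a n t * c t * F t)" for n
    proof (rule Bochner_Integration.integrable_bound[OF F1])
      show "(\<lambda>t. harmonic a n t * c t * F t) \<in> borel_measurable lebesgue"
        by (intro borel_measurable_times F measurable_completion) auto
    qed (simp add: norm_mult cn)
    have int: "integrable lebesgue (\<lambda>t. \<Sum>n\<in>{-N..N}. b n * (harmonic a n t * c t * F t))"
      using hF by (intro Bochner_Integration.integrable_sum) auto
    have eq: "(\<Sum>n\<in>{-N..N}. b n * (harmonic a n t * c t * F t)) = p t * c t * F t" for t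
      by (simp add: p_def sum_distrib_right mult.assoc)
    have "(\<Sum>n\<in>{-N..N}. b n * f ((of_int n + \<delta>) / a)) =
        (LINT t|lebesgue. (\<Sum>n\<in>{-N..N}. b n * (harmonic a n t * c t * F t)))"
      unfolding f split using hF by (simp add: Bochner_Integration.integral_sum)
    then have "ennreal (norm (\<Sum>n\<in>{-N..N}. b n * f ((of_int n + \<delta>) / a))) \<le>
        (\<integral>\<^sup>+t. ennreal (norm (p t * c t * F t)) \<partial>lebesgue)"
      using integral_norm_bound_ennreal[OF int] by (simp add: eq)
    also have "\<dots> \<le> (\<integral>\<^sup>+t. ennreal (s / 2) * (u t * ennreal (1 / g t)) + ennreal (1 / (2 * s)) * ennreal (g t * (norm (F t))\<^sup>2) \<partial>lebesgue)"
    proof (rule nn_integral_mono_AE, use supp in eventually_elim)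
      fix t assume t: "?e t \<in> C \<longrightarrow> F t = 0"
      have "norm (p t * c t * F t) = indicator (- C) (?e t) * norm (p t) * norm (F t)"
        using t by (auto simp: norm_mult cn indicator_def)
      \<comment> \<open>The parameter \<open>s / g t\<close> puts the weight on \<open>F\<close>,
        giving the Sobolev integral \<open>I\<close>, and its reciprocal on the polynomial, where
        the periodic bound applies.\<close>
      also have "\<dots> \<le> (s / g t * (indicator (- C) (?e t) * norm (p t))\<^sup>2 + (norm (F t))\<^sup>2 / (s / g t)) / 2"
        using s g by (intro weighted_AM_GM) auto
      also have "\<dots> = s / 2 * (indicator (- C) (?e t) * (norm (p t))\<^sup>2 * (1 / g t)) + 1 / (2 * s) * (g t * (norm (F t))\<^sup>2)"
        by (simp add: indicator_def field_simps)
      finally have "ennreal (norm (p t * c t * F t)) \<le> ennreal \<dots>" by (rule ennreal_leI)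
      also have "\<dots> = ennreal (s / 2) * (u t * ennreal (1 / g t)) + ennreal (1 / (2 * s)) * ennreal (g t * (norm (F t))\<^sup>2)"
        using s g[of t] by (simp add: u_def ennreal_mult[symmetric] ennreal_plus[symmetric] del: ennreal_plus)
      finally show "ennreal (norm (p t * c t * F t)) \<le> ennreal (s / 2) * (u t * ennreal (1 / g t)) + ennreal (1 / (2 * s)) * ennreal (g t * (norm (F t))\<^sup>2)" .
    qed
    also have "\<dots> = ennreal (s / 2) * (\<integral>\<^sup>+t. u t * ennreal (1 / g t) \<partial>lebesgue) +
        ennreal (1 / (2 * s)) * (\<integral>\<^sup>+t. ennreal (g t * (norm (F t))\<^sup>2) \<partial>lebesgue)"
    proof -
      have [measurable]: "(\<lambda>t. u t * ennreal (1 / g t)) \<in> borel_measurable lebesgue"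
        by (rule measurable_completion) measurable
      have [measurable]: "g \<in> borel_measurable lebesgue" by (rule measurable_completion) measurable
      note F [measurable]
      show ?thesis by (simp add: nn_integral_add nn_integral_cmult)
    qed
    also have "(\<integral>\<^sup>+t. ennreal (g t * (norm (F t))\<^sup>2) \<partial>lebesgue) = ennreal I"
      unfolding I_def by (rule nn_integral_eq_integral) (use intF g in \<open>auto simp: g_def\<close>)
    also have "ennreal (s / 2) * (\<integral>\<^sup>+t. u t * ennreal (1 / g t) \<partial>lebesgue) + ennreal (1 / (2 * s)) * ennreal I
        \<le> ennreal (s / 2) * ennreal (K * \<epsilon>) + ennreal (1 / (2 * s)) * ennreal I"
      using U by (intro add_right_mono mult_left_mono) auto
    also have "\<dots> = ennreal (s / 2 * (K * \<epsilon>) + 1 / (2 * s) * I)"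
      using s K(1) I0 \<epsilon> by (simp add: ennreal_mult[symmetric] ennreal_plus[symmetric] del: ennreal_plus)
    finally have "norm (\<Sum>n\<in>{-N..N}. b n * f ((of_int n + \<delta>) / a)) \<le> s / 2 * (K * \<epsilon>) + 1 / (2 * s) * I"
      using s K(1) I0 \<epsilon> by (subst (asm) ennreal_le_iff) auto
    also have "\<dots> \<le> (K + I) * (s * \<epsilon> + 1 / s)"
    proof -
      have "0 \<le> K * (s * \<epsilon>)" "0 \<le> I / s" "0 \<le> K / s" "0 \<le> I * (s * \<epsilon>)" using s K(1) I0 \<epsilon> by auto
      then show ?thesis by (simp add: algebra_simps add_divide_distrib)
    qed
    finally show "norm (\<Sum>n\<in>{-N..N}. b n * f ((of_int n + \<delta>) / a)) \<le> (K + I) * (s * \<epsilon> + 1 / s)" .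
  qed
qed

lemma continuous_on_inverse_Fourier:
  fixes F :: "real \<Rightarrow> complex"
  assumes "integrable lebesgue F"
    and f: "\<And>x. f x = (LINT t|lebesgue. exp (complex_of_real (2 * pi * t * x) * \<i>) * F t)"
  shows "continuous_on UNIV f"
proof (rule continuous_at_imp_continuous_on, rule ballI)
  fix x :: real
  have "(\<lambda>k. f (y k)) \<longlonglongrightarrow> f x" if y: "y \<longlonglongrightarrow> x" for y
    unfolding f
  proof (rule integral_dominated_convergence[where w = "\<lambda>t. norm (F t)"])
    have meas: "(\<lambda>t. exp (complex_of_real (2 * pi * t * z) * \<i>)) \<in> borel_measurable lebesgue" for z
      by (rule measurable_completion) (auto intro!: borel_measurable_continuous_onI continuous_intros)
    then show "(\<lambda>t. exp (complex_of_real (2 * pi * t * x) * \<i>) * F t) \<in> borel_measurable lebesgue"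
      "\<And>k. (\<lambda>t. exp (complex_of_real (2 * pi * t * y k) * \<i>) * F t) \<in> borel_measurable lebesgue"
      using assms(1) by (auto intro!: borel_measurable_times)
    show "integrable lebesgue (\<lambda>t. norm (F t))" using assms(1) by (rule integrable_norm)
    show "AE t in lebesgue. (\<lambda>k. exp (complex_of_real (2 * pi * t * y k) * \<i>) * F t)
        \<longlonglongrightarrow> exp (complex_of_real (2 * pi * t * x) * \<i>) * F t"
      using y by (intro AE_I2 tendsto_intros)
    show "AE t in lebesgue. norm (exp (complex_of_real (2 * pi * t * y k) * \<i>) * F t) \<le> norm (F t)" for k
      by (simp add: norm_mult norm_exp_eq_Re)
  qed
  then show "isCont f x" unfolding continuous_at_sequentially by (auto simp: o_def)
qed

lemma eq_zero_if_zero_on_rational_shifts: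
  assumes "a > 0" "continuous_on UNIV (f :: real \<Rightarrow> complex)"
    and "\<And>(m::int) q. q \<in> \<rat> \<Longrightarrow> 0 \<le> q \<Longrightarrow> q < 1 \<Longrightarrow> f ((of_int m + q) / a) = 0"
  shows "f = (\<lambda>_. 0)"
proof
  fix x
  have rat: "f (y / a) = 0" if "y \<in> \<rat>" for y
  proof -
    have "frac y \<in> \<rat>" using that by (simp add: frac_def)
    then show ?thesis
      using assms(3)[of "frac y" "\<lfloor>y\<rfloor>"] frac_ge_0[of y] frac_lt_1[of y] by (simp add: frac_def)
  qed
  have "continuous_on UNIV (\<lambda>y. f (y / a))"
    using assms(1) by (intro continuous_on_compose2[OF assms(2)] continuous_intros) auto
  moreover have "x * a \<in> closure (\<rat> :: real set)" by (simp add: Rats_closure_real)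
  ultimately have "f (x * a / a) = 0"
    by (intro continuous_constant_on_closure[of \<rat> "\<lambda>y. f (y / a)" 0 "x * a"])
       (auto intro: rat continuous_on_subset)
  then show "f x = 0" using assms(1) by simp
qed

section \<open>Slowly perturbed lattices\<close>

lemma strict_mono_int_ge:
  fixes Ms :: "nat \<Rightarrow> int"
  assumes "strict_mono Ms" "Ms 0 = 0"
  shows "int i \<le> Ms i"
proof (induction i)
  case (Suc i)
  then show ?case using strict_monoD[OF assms(1), of i "Suc i"] by simp
qed (simp add: assms(2))

text \<open>Each block is nonempty, so neighbouring integers lie in the same block or in adjacent
  ones, and the shift changes by at most one step of \<open>d\<close>.\<close>

lemma block_shifts:
  fixes Ms :: "nat \<Rightarrow> int" and d :: "nat \<Rightarrow> real"
  assumes "strict_mono Ms" "Ms 0 = 0" and d: "\<And>i. \<bar>d (Suc i) - d i\<bar> \<le> 1 / 2"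
  obtains \<alpha> :: "int \<Rightarrow> real" where
    "\<And>i n. Ms i < \<bar>n\<bar> \<Longrightarrow> \<bar>n\<bar> \<le> Ms (Suc i) \<Longrightarrow> \<alpha> n = d i"
    "\<And>n. \<exists>i. \<alpha> n = d i" "\<And>n. \<bar>\<alpha> (n + 1) - \<alpha> n\<bar> \<le> 1 / 2"
proof -
  \<comment> \<open>The index of the block of \<open>n\<close>. The integer 0 lies in no block, and
    \<open>LEAST\<close> assigns it to block 0.\<close>
  define ix where "ix n = (LEAST i. \<bar>n\<bar> \<le> Ms (Suc i))" for n
  have step: "Ms i + 1 \<le> Ms (Suc i)" for i
    using strict_monoD[OF assms(1), of i "Suc i"] by simp
  note lower = strict_mono_int_ge[OF assms(1,2)]
  have ix: "\<bar>n\<bar> \<le> Ms (Suc (ix n))" for n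
    unfolding ix_def
  proof (rule LeastI_ex)
    show "\<exists>i. \<bar>n\<bar> \<le> Ms (Suc i)"
      using lower[of "Suc (nat \<bar>n\<bar>)"] by (intro exI[of _ "nat \<bar>n\<bar>"]) simp
  qed
  have ix_le: "ix n \<le> i" if "\<bar>n\<bar> \<le> Ms (Suc i)" for n i
    unfolding ix_def using that by (rule Least_le)
  have ix_eq: "ix n = i" if "Ms i < \<bar>n\<bar>" "\<bar>n\<bar> \<le> Ms (Suc i)" for n i
  proof (rule antisym[OF ix_le[OF that(2)]], rule ccontr)
    assume "\<not> i \<le> ix n"
    then have "Ms (Suc (ix n)) \<le> Ms i"
      using assms(1) by (auto simp: strict_mono_less_eq)
    then show False using ix[of n] that(1) by linarith
  qed
  have ix_adj: "ix k \<le> Suc (ix n)" if "\<bar>k\<bar> \<le> \<bar>n\<bar> + 1" for k n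
    using ix[of n] step[of "Suc (ix n)"] that by (intro ix_le) linarith
  show thesis
  proof (rule that[of "\<lambda>n. d (ix n)"])
    fix n :: int
    have "ix (n + 1) \<le> Suc (ix n)" "ix n \<le> Suc (ix (n + 1))"
      by (auto intro!: ix_adj)
    then consider "ix (n + 1) = ix n" | "ix (n + 1) = Suc (ix n)" | "ix n = Suc (ix (n + 1))"
      by linarith
    then show "\<bar>d (ix (n + 1)) - d (ix n)\<bar> \<le> 1 / 2"
      using d[of "ix n"] d[of "ix (n + 1)"] by cases (auto simp: abs_minus_commute)
  qed (auto simp: ix_eq)
qed

lemma recurrent_slow_sequence:
  obtains d :: "nat \<Rightarrow> real" where "\<And>i. 0 \<le> d i" "\<And>i. d i < 1" "\<And>i. \<bar>d (Suc i) - d i\<bar> \<le> 1 / 2"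
    "\<And>q I. q \<in> \<rat> \<Longrightarrow> 0 \<le> q \<Longrightarrow> q < 1 \<Longrightarrow> \<exists>i\<ge>I. d i = q"
proof -
  define Q where "Q = \<rat> \<inter> {0..<1::real}"
  have Q: "countable Q" "Q \<noteq> {}" by (auto simp: Q_def countable_rat intro!: exI[of _ 0])
  define r where "r = from_nat_into Q"
  have r: "r j \<in> Q" for j unfolding r_def by (rule from_nat_into[OF Q(2)])
  \<comment> \<open>Returning to \<open>1/2\<close> at every second step keeps consecutive values at distance at most \<open>1/2\<close>.\<close>
  define d where "d i = (if even i then 1 / 2 else r (fst (prod_decode (i div 2))))" for i :: nat
  have dr: "0 \<le> d i \<and> d i < 1" for i using r by (auto simp: d_def Q_def)
  show thesis
  proof (rule that[of d])
    show "\<bar>d (Suc i) - d i\<bar> \<le> 1 / 2" for i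
    proof (cases "even i")
      case True
      then have "d i = 1 / 2" by (simp add: d_def)
      then show ?thesis using dr[of "Suc i"] by linarith
    next
      case False
      then have "d (Suc i) = 1 / 2" by (simp add: d_def)
      then show ?thesis using dr[of i] by linarith
    qed
    fix q :: real and I :: nat assume "q \<in> \<rat>" "0 \<le> q" "q < 1"
    then have "q \<in> range r" using range_from_nat_into[OF Q(2,1)] by (auto simp: r_def Q_def)
    then obtain j where j: "q = r j" by blast
    \<comment> \<open>An odd position whose half decodes to a pair starting with \<open>j\<close>.
      The second component is arbitrary, so the value recurs beyond any \<open>I\<close>.\<close>
    have "d (2 * prod_encode (j, I) + 1) = q" by (simp add: d_def j)
    moreover have "I \<le> 2 * prod_encode (j, I) + 1" using le_prod_encode_2[of I j] by simp
    ultimately show "\<exists>i\<ge>I. d i = q" by blast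
  qed (use dr in auto)
qed

section \<open>Separation and density of the perturbed lattice\<close>

text \<open>Shifts in \<open>[0, 1)\<close> keep integers at distance 2 or more apart; for adjacent
  integers the slow variation of the shifts prevents near-collisions.\<close>

lemma perturbed_integers_gap:
  fixes \<alpha> :: "int \<Rightarrow> real"
  assumes "\<And>n. 0 \<le> \<alpha> n" "\<And>n. \<alpha> n < 1" "\<And>n. \<bar>\<alpha> (n + 1) - \<alpha> n\<bar> \<le> 1 / 2" "n < m"
  shows "1 / 2 \<le> (of_int m + \<alpha> m) - (of_int n + \<alpha> n)"
proof (cases "m = n + 1")
  case True
  have "real_of_int m = of_int n + 1" "\<alpha> m = \<alpha> (n + 1)" using True by auto
  then show ?thesis using assms(3)[of n] by linarith
next
  case False
  then have "real_of_int n + 2 \<le> of_int m" using assms(4) by linarith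
  then show ?thesis using assms(1)[of m] assms(2)[of n] by linarith
qed

lemma uniformly_discrete_perturbed_lattice:
  assumes "a > 0" "\<And>n. 0 \<le> \<alpha> n" "\<And>n. \<alpha> n < 1" "\<And>n. \<bar>\<alpha> (n + 1) - \<alpha> n\<bar> \<le> 1 / 2"
  shows "uniformly_discrete (range (\<lambda>n::int. (of_int n + \<alpha> n) / a))"
proof -
  note gap = perturbed_integers_gap[of \<alpha>, OF assms(2-4)]
  have *: "1 / (2 * a) \<le> \<bar>(of_int n + \<alpha> n) / a - (of_int m + \<alpha> m) / a\<bar>" if "n \<noteq> m" for m n :: int
  proof -
    have "1 / 2 \<le> \<bar>(of_int n + \<alpha> n) - (of_int m + \<alpha> m)\<bar>"
      using gap[of n m] gap[of m n] that by linarith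
    then have "1 / 2 / a \<le> \<bar>(of_int n + \<alpha> n) - (of_int m + \<alpha> m)\<bar> / a"
      using assms(1) by (intro divide_right_mono) auto
    then show ?thesis using assms(1) by (simp add: diff_divide_distrib[symmetric])
  qed
  have "1 / (2 * a) \<le> \<bar>l - m\<bar>"
    if lm: "l \<in> range (\<lambda>n::int. (of_int n + \<alpha> n) / a)" "m \<in> range (\<lambda>n::int. (of_int n + \<alpha> n) / a)" "l \<noteq> m" for l m
  proof -
    obtain i j where ij: "l = (of_int i + \<alpha> i) / a" "m = (of_int j + \<alpha> j) / a"
      using lm(1,2) by blast
    moreover have "i \<noteq> j" using lm(3) ij by auto
    ultimately show ?thesis using * by simp
  qed
  then show ?thesis
    unfolding uniformly_discrete_def using assms(1)
    by (intro exI[of _ "1 / (2 * a)"] conjI ballI impI) auto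
qed

text \<open>Moving each lattice point by a bounded amount changes the count in an interval by a
  bounded amount, here at most 4 uniformly in \<open>x\<close>; this is below
  \<open>\<epsilon> * r\<close> once \<open>r\<close> reaches \<open>4 / \<epsilon>\<close>.\<close>

lemma uniform_density_perturbed_lattice:
  assumes "a > 0" "\<And>n. 0 \<le> \<alpha> n" "\<And>n. \<alpha> n < 1" "\<And>n. \<bar>\<alpha> (n + 1) - \<alpha> n\<bar> \<le> 1 / 2"
  shows "has_uniform_density (range (\<lambda>n::int. (of_int n + \<alpha> n) / a)) a"
proof -
  let ?l = "\<lambda>n::int. (of_int n + \<alpha> n) / a"
  define J where "J x r = {n. x < ?l n \<and> ?l n < x + r}" for x r
  have J: "range ?l \<inter> {x<..<x + r} = ?l ` J x r" for x r by (auto simp: J_def)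
  have J_iff: "n \<in> J x r \<longleftrightarrow> x * a < of_int n + \<alpha> n \<and> of_int n + \<alpha> n < x * a + r * a" for n x r
    using assms(1) by (auto simp: J_def field_simps)
  have upper: "J x r \<subseteq> {\<lfloor>x * a\<rfloor>..\<lceil>x * a + r * a\<rceil>}" for x r
  proof
    fix n assume "n \<in> J x r"
    then have "x * a < of_int n + 1" "of_int n < x * a + r * a"
      using assms(2)[of n] assms(3)[of n] by (auto simp: J_iff)
    then show "n \<in> {\<lfloor>x * a\<rfloor>..\<lceil>x * a + r * a\<rceil>}" by (simp add: floor_le_iff le_ceiling_iff)
  qed
  \<comment> \<open>At the upper end, one unit allows for the shift and another for the strict
    inequality.\<close>
  have lower: "{\<lfloor>x * a\<rfloor> + 1..\<lceil>x * a + r * a\<rceil> - 2} \<subseteq> J x r" for x r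
  proof
    fix n assume "n \<in> {\<lfloor>x * a\<rfloor> + 1..\<lceil>x * a + r * a\<rceil> - 2}"
    then have "x * a < of_int n" "of_int n + 1 < x * a + r * a" by (simp; linarith)+
    then show "n \<in> J x r" using assms(2)[of n] assms(3)[of n] by (auto simp: J_iff)
  qed
  have fin: "finite (J x r)" for x r using upper by (rule finite_subset) simp
  have card_eq: "card (range ?l \<inter> {x<..<x + r}) = card (J x r)" for x r
  proof -
    have "inj ?l"
    proof (rule linorder_injI)
      fix n m :: int assume "n < m"
      then show "?l n \<noteq> ?l m"
        using perturbed_integers_gap[of \<alpha>, OF assms(2-4), of n m] assms(1) by auto
    qed
    then show ?thesis unfolding J by (intro card_image) (auto intro: inj_on_subset)
  qed
  have count: "\<bar>real (card (J x r)) - r * a\<bar> \<le> 4" if "r \<ge> 0" for x r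
  proof -
    have ra: "0 \<le> r * a" using that assms(1) by simp
    have "card (J x r) \<le> card {\<lfloor>x * a\<rfloor>..\<lceil>x * a + r * a\<rceil>}"
      using upper by (intro card_mono) auto
    moreover have "card {\<lfloor>x * a\<rfloor> + 1..\<lceil>x * a + r * a\<rceil> - 2} \<le> card (J x r)"
      using lower fin by (intro card_mono) auto
    moreover have "\<lfloor>x * a\<rfloor> \<le> \<lceil>x * a + r * a\<rceil>"
      using ra by (intro order_trans[OF floor_le_ceiling ceiling_mono]) auto
    ultimately have "int (card (J x r)) \<le> \<lceil>x * a + r * a\<rceil> - \<lfloor>x * a\<rfloor> + 1"
      "\<lceil>x * a + r * a\<rceil> - \<lfloor>x * a\<rfloor> - 2 \<le> int (card (J x r))"
      unfolding card_atLeastAtMost_int by linarith+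
    then have "real (card (J x r)) \<le> of_int \<lceil>x * a + r * a\<rceil> - of_int \<lfloor>x * a\<rfloor> + 1"
      "of_int \<lceil>x * a + r * a\<rceil> - of_int \<lfloor>x * a\<rfloor> - 2 \<le> real (card (J x r))"
      by linarith+
    moreover have "of_int \<lfloor>x * a\<rfloor> \<le> x * a" "x * a < of_int \<lfloor>x * a\<rfloor> + 1"
      "of_int \<lceil>x * a + r * a\<rceil> < x * a + r * a + 1" "x * a + r * a \<le> of_int \<lceil>x * a + r * a\<rceil>"
      by linarith+
    ultimately show ?thesis by linarith
  qed
  show ?thesis
    unfolding has_uniform_density_def
  proof (intro conjI allI impI)
    show "finite (range ?l \<inter> {x<..<x + r})" for x r unfolding J using fin by simp
    fix \<epsilon> :: real assume \<epsilon>: "\<epsilon> > 0"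
    have "\<bar>real (card (range ?l \<inter> {x<..<x + r})) - r * a\<bar> \<le> \<epsilon> * r" if "r \<ge> 4 / \<epsilon>" for r x
    proof -
      have "r \<ge> 0" using that \<epsilon> by (meson divide_nonneg_pos order_trans zero_le_numeral)
      moreover have "4 \<le> \<epsilon> * r" using that \<epsilon> by (simp add: field_simps)
      ultimately show ?thesis using count[of r x] unfolding card_eq by linarith
    qed
    then show "\<exists>R. \<forall>r\<ge>R. \<forall>x. \<bar>real (card (range ?l \<inter> {x<..<x + r})) - r * a\<bar> \<le> \<epsilon> * r" by blast
  qed
qed

section \<open>The uniqueness set\<close>

theorem theorem3:
  fixes S :: "real set" and a :: real
  assumes "S \<in> sets lebesgue"
    and "a > 0"
    and "emeasure lebesgue (periodized_trace S a) < ennreal a"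
  shows "\<exists>\<Lambda>. uniformly_discrete \<Lambda> \<and> has_uniform_density \<Lambda> a \<and>
           (\<forall>\<alpha>>1/2. uniqueness_set \<Lambda> (W_space \<alpha> S))"
proof -
  note a = assms(2)
  obtain C where C: "closed C" "emeasure (circle_measure a) {t\<in>{0..a}. harmonic a 1 t \<in> C} \<noteq> 0"
    "\<And>t. t \<in> S \<Longrightarrow> harmonic a 1 t \<notin> C"
    using periodized_trace_avoiding_closed_set[OF assms] by blast
  \<comment> \<open>With \<open>s = i + 1\<close> in the sample estimate, both terms equal
    \<open>1 / (i + 1)\<close>, so the bound tends to 0.\<close>
  define \<epsilon> where "\<epsilon> i = 1 / (real i + 1)\<^sup>2" for i
  have \<epsilon>: "\<epsilon> i > 0" for i by (simp add: \<epsilon>_def)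
  have "\<exists>Ms. \<forall>i. (i = 0 \<longrightarrow> Ms i = 0) \<and> gap_approximable a C (\<epsilon> i) (Ms i) (Ms (Suc i))"
  proof (rule dependent_nat_choice)
    fix M i
    obtain N where "gap_approximable a C (\<epsilon> i) M N"
      using gap_approximable_exists[OF a C(1,2) \<epsilon>] .
    then show "\<exists>N. (Suc i = 0 \<longrightarrow> N = 0) \<and> gap_approximable a C (\<epsilon> i) M N" by auto
  qed simp
  then obtain Ms where "\<forall>i. (i = 0 \<longrightarrow> Ms i = 0) \<and> gap_approximable a C (\<epsilon> i) (Ms i) (Ms (Suc i))" ..
  then have Ms: "Ms 0 = 0" "gap_approximable a C (\<epsilon> i) (Ms i) (Ms (Suc i))" for i by auto
  have mono: "strict_mono Ms"
    using Ms(2) by (auto simp: strict_mono_Suc_iff gap_approximable_def)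
  obtain d :: "nat \<Rightarrow> real" where d: "\<And>i. 0 \<le> d i" "\<And>i. d i < 1" "\<And>i. \<bar>d (Suc i) - d i\<bar> \<le> 1 / 2"
    "\<And>q I. q \<in> \<rat> \<Longrightarrow> 0 \<le> q \<Longrightarrow> q < 1 \<Longrightarrow> \<exists>i\<ge>I. d i = q"
    using recurrent_slow_sequence by metis
  obtain \<beta> :: "int \<Rightarrow> real" where \<beta>: "\<And>i n. Ms i < \<bar>n\<bar> \<Longrightarrow> \<bar>n\<bar> \<le> Ms (Suc i) \<Longrightarrow> \<beta> n = d i"
    "\<And>n. \<exists>i. \<beta> n = d i" "\<And>n. \<bar>\<beta> (n + 1) - \<beta> n\<bar> \<le> 1 / 2"
    using block_shifts[where d = d, OF mono Ms(1) d(3)] by blast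
  have \<beta>r: "0 \<le> \<beta> n" "\<beta> n < 1" for n using \<beta>(2)[of n] d(1,2) by auto
  \<comment> \<open>Fixed before \<open>\<alpha>\<close> and \<open>f\<close> are introduced, so one
    set serves all the spaces; only the constant \<open>K\<close> below depends on the
    function.\<close>
  define \<Lambda> where "\<Lambda> = range (\<lambda>n::int. (of_int n + \<beta> n) / a)"
  have "uniqueness_set \<Lambda> (W_space \<alpha> S)" if \<alpha>: "\<alpha> > 1 / 2" for \<alpha>
    unfolding uniqueness_set_def
  proof (intro ballI impI)
    fix f assume "f \<in> W_space \<alpha> S" and van: "\<forall>l\<in>\<Lambda>. f l = 0"
    then obtain F where F: "F \<in> borel_measurable lebesgue"
      "integrable lebesgue (\<lambda>t. (1 + \<bar>t\<bar> powr (2 * \<alpha>)) * (cmod (F t))\<^sup>2)"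
      "AE t in lebesgue. t \<notin> S \<longrightarrow> F t = 0"
      "\<And>x. f x = (LINT t|lebesgue. exp (complex_of_real (2 * pi * t * x) * \<i>) * F t)"
      unfolding W_space_def by blast
    have supp: "AE t in lebesgue. harmonic a 1 t \<in> C \<longrightarrow> F t = 0"
      using F(3) by eventually_elim (use C(3) in blast)
    obtain K where K: "\<forall>N b s \<epsilon> \<delta>. s > 0 \<longrightarrow> \<epsilon> > 0 \<longrightarrow>
      (\<integral>\<^sup>+t. ennreal (indicator (- C) (harmonic a 1 t) * (norm (\<Sum>n\<in>{-N..N}. b n * harmonic a n t))\<^sup>2)
        \<partial>circle_measure a) \<le> ennreal \<epsilon> \<longrightarrow>
      norm (\<Sum>n\<in>{-N..N}. b n * f ((of_int n + \<delta>) / a)) \<le> K * (s * \<epsilon> + 1 / s)"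
      using W_space_value_estimate[OF a \<alpha> F(1,2,4) supp C(1)] ..
    have bound: "norm (f ((of_int m + d i) / a)) \<le> 2 * K / (real i + 1)" if m: "\<bar>m\<bar> \<le> Ms i" for m i
    proof -
      let ?N = "Ms (Suc i)"
      obtain b where b: "b m = 1" "\<And>n. \<bar>n\<bar> \<le> Ms i \<Longrightarrow> n \<noteq> m \<Longrightarrow> b n = 0"
        "(\<integral>\<^sup>+t. ennreal (indicator (- C) (harmonic a 1 t) * (norm (\<Sum>n\<in>{- ?N..?N}. b n * harmonic a n t))\<^sup>2)
          \<partial>circle_measure a) \<le> ennreal (\<epsilon> i)" and "Ms i < ?N"
        using Ms(2)[of i] m unfolding gap_approximable_def by blast
      \<comment> \<open>Low frequencies other than \<open>m\<close> have coefficient 0. The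
        remaining ones lie in block \<open>i\<close>, where the shift is exactly \<open>d i\<close>,
        so the sample point belongs to \<open>\<Lambda>\<close>.\<close>
      have other: "b n * f ((of_int n + d i) / a) = 0" if n: "n \<in> {- ?N..?N} - {m}" for n
      proof (cases "\<bar>n\<bar> \<le> Ms i")
        case True
        then show ?thesis using b(2)[of n] n by simp
      next
        case False
        then have "\<beta> n = d i" using n by (intro \<beta>(1)) auto
        then have "(of_int n + d i) / a \<in> \<Lambda>" by (auto simp: \<Lambda>_def intro!: image_eqI[of _ _ n])
        then show ?thesis using van by simp
      qed
      have "(\<Sum>n\<in>{- ?N..?N} - {m}. b n * f ((of_int n + d i) / a)) = 0"
        using other by (intro sum.neutral) blast
      then have "(\<Sum>n\<in>{- ?N..?N}. b n * f ((of_int n + d i) / a)) = b m * f ((of_int m + d i) / a)"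
        using m \<open>Ms i < ?N\<close> by (subst sum.remove[of _ m]) auto
      moreover have "norm (\<Sum>n\<in>{- ?N..?N}. b n * f ((of_int n + d i) / a))
          \<le> K * ((real i + 1) * \<epsilon> i + 1 / (real i + 1))"
        by (rule K[rule_format]) (use \<epsilon> b(3) in auto)
      ultimately have "norm (f ((of_int m + d i) / a)) \<le> K * ((real i + 1) * \<epsilon> i + 1 / (real i + 1))"
        using b(1) by simp
      also have "\<dots> = 2 * K / (real i + 1)"
        by (simp add: \<epsilon>_def power2_eq_square)
      finally show ?thesis .
    qed
    have "f ((of_int m + q) / a) = 0" if q: "q \<in> \<rat>" "0 \<le> q" "q < 1" for q and m :: int
    proof (rule ccontr)
      assume "f ((of_int m + q) / a) \<noteq> 0"
      then have pos: "norm (f ((of_int m + q) / a)) > 0" by simp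
      obtain I1 :: nat where I1: "2 * K / norm (f ((of_int m + q) / a)) < real I1"
        using reals_Archimedean2 by blast
      \<comment> \<open>The shift \<open>q\<close> recurs in late blocks. Taking \<open>i\<close> at
        least \<open>\<bar>m\<bar>\<close> puts \<open>m\<close> inside them, and taking it at least
        \<open>I1\<close> makes the bound smaller than the assumed nonzero value.\<close>
      obtain i where i: "i \<ge> max I1 (nat \<bar>m\<bar>)" "d i = q" using d(4)[OF q] by blast
      have "\<bar>m\<bar> \<le> Ms i" using i(1) strict_mono_int_ge[OF mono Ms(1), of i] by linarith
      then have "norm (f ((of_int m + q) / a)) \<le> 2 * K / (real i + 1)" using bound i(2) by blast
      then have "real i + 1 \<le> 2 * K / norm (f ((of_int m + q) / a))"
        using pos by (simp add: field_simps)
      also have "\<dots> < real I1" by fact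
      also have "real I1 \<le> real i" using i(1) by simp
      finally show False by simp
    qed
    then show "f = (\<lambda>_. 0)"
      by (rule eq_zero_if_zero_on_rational_shifts[OF a continuous_on_inverse_Fourier[OF integrable_of_weighted_square[OF \<alpha> F(1,2)] F(4)]])
  qed
  moreover have "uniformly_discrete \<Lambda>"
    unfolding \<Lambda>_def by (rule uniformly_discrete_perturbed_lattice[where \<alpha> = \<beta>, OF a \<beta>r \<beta>(3)])
  moreover have "has_uniform_density \<Lambda> a"
    unfolding \<Lambda>_def
    by (rule uniform_density_perturbed_lattice[where \<alpha> = \<beta>, OF a \<beta>r \<beta>(3)])
  ultimately show ?thesis by blast
qed

end
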